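(* Let $G$ be a square, triangular or hexagonal lattice with $N$ vertices. Let $\tau^b$ be an optimal stopping time for the blind game on $G$, let $\tau^f$ be an optimal stopping time for the full information game on $G$, and put $c^b=\frac1N\mathbb{E}[\tilde{C}_{\tau^b}]$ and $c^f=\frac1N\mathbb{E}[\tilde{C}_{\tau^f}]$. Then for all sufficiently large $N$: \[ 0.12953\le c^b\le 0.13268 \quad\text{if } G \text{ is the square lattice}, \] \[ 0.09629\le c^b\le 0.10107 \quad\text{if } G \text{ is the triangular lattice}, \] \[ 0.16738\le c^b\le 0.17144 \quad\text{if } G \text{ is the hexagonal lattice}. \] Furthermore, for every $\varepsilon\in(0,1)$ and all sufficiently large $N$ (depending on $\varepsilon$), $c^b\le c^f\le c^b+\varepsilon$.
   Context: Lattices. The square lattice on $N=n^2$ vertices has vertex set $\{1,\ldots,n\}^2$, two vertices being adjacent iff they are at Euclidean distance $1$. The triangular lattice on $N=n^2$ vertices has vertex set $\{1,\ldots,n\}^2$, with $(i,j)$ adjacent to $(i+1,j)$, $(i,j+1)$ and $(i+1,j-1)$ whenever these belong to the vertex set (and no other edges). The hexagonal lattice with parameter $m\ge1$: take the regular hexagons of side length $1$ with two horizontal sides, centred at $\left(\tfrac32 j,\ \sqrt3\,(i+\tfrac12(j\bmod 2))\right)$ for $0\le j\le m-1$, where $0\le i\le m-1$ if $j$ is even and $0\le i\le m-2$ if $j$ is odd; the vertices are the corners and the edges are the sides of these hexagons, and $N$ is the number of vertices. Games. Let $G=(V,E)$ be a graph with $|V|=N$. Let $\mathcal{S}$ be the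 set of all permutations $\sigma=(\sigma_1,\ldots,\sigma_N)$ of $V$ with the uniform probability measure. For $t\in\{1,\ldots,N\}$, $\tilde{G}_t(\sigma)$ is the subgraph of $G$ induced by $\{\sigma_1,\ldots,\sigma_t\}$, and $\tilde{C}_t(\sigma)$ is its number of connected components. Given a filtration $\mathcal{P}_1\subseteq\cdots\subseteq\mathcal{P}_N$ of $\sigma$-algebras of subsets of $\mathcal{S}$, a stopping time is a function $\tau:\mathcal{S}\to\{1,\ldots,N\}$ with $\tau^{-1}(t)\in\mathcal{P}_t$ for all $t$; $\mathbb{E}[\tilde{C}_\tau]=\frac{1}{N!}\sum_{\sigma\in\mathcal{S}}\tilde{C}_{\tau(\sigma)}(\sigma)$; and $\tau$ is optimal if it maximizes $\mathbb{E}[\tilde{C}_\tau]$ among all stopping times for the given filtration. Blind game: $\mathcal{P}_t=\{\emptyset,\mathcal{S}\}$ for every $t$ (so stopping times are constants). Full information game: $\mathcal{P}_t$ consists of all $A\subseteq\mathcal{S}$ such that whenever $\sigma\in A$ and $\pi\in\mathcal{S}$ satisfies $\pi_i=\sigma_i$ for all $i\le t$, then $\pi\in A$. *)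

theory Defs
  imports "HOL-Analysis.Analysis" "HOL-Combinatorics.Multiset_Permutations"
begin

text \<open>Edges are two-element sets of vertices.\<close>

record 'a graph =
  verts :: "'a set"
  edges :: "'a set set"

definition induced :: "'a graph \<Rightarrow> 'a set \<Rightarrow> 'a graph" where
  "induced G W = \<lparr>verts = verts G \<inter> W, edges = {e \<in> edges G. e \<subseteq> W}\<rparr>"

definition components :: "'a graph \<Rightarrow> 'a set set" where
  "components G = verts G // {(u, v). {u, v} \<in> edges G}\<^sup>*"

text \<open>All lattices are drawn in the Euclidean plane, so that \<^term>\<open>dist\<close> on pairs is the
  Euclidean distance.\<close>

type_synonym plane = "real \<times> real"

definition grid :: "nat \<Rightarrow> plane set" where
  "grid n = {(real i, real j) | i j. i \<in> {1..n} \<and> j \<in> {1..n}}"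

definition square_lattice :: "nat \<Rightarrow> plane graph" where
  "square_lattice n =
     \<lparr>verts = grid n, edges = {{u, v} | u v. u \<in> grid n \<and> v \<in> grid n \<and> dist u v = 1}\<rparr>"

definition triangular_lattice :: "nat \<Rightarrow> plane graph" where
  "triangular_lattice n =
     \<lparr>verts = grid n,
      edges = {{u, v} | u v. u \<in> grid n \<and> v \<in> grid n \<and> v - u \<in> {(1, 0), (0, 1), (1, -1)}}\<rparr>"

definition hex_centres :: "nat \<Rightarrow> plane set" where
  "hex_centres m =
     {(3 / 2 * real j, sqrt 3 * (real i + 1 / 2 * real (j mod 2))) | i j.
        j < m \<and> (if even j then i < m else i + 1 < m)}"

text \<open>Corners of the regular hexagon of side length 1 with two horizontal sides, in
  counterclockwise order starting from the rightmost one; \<open>k = 6\<close> gives the same point as \<open>k = 0\<close>.\<close>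

definition hex_corner :: "plane \<Rightarrow> nat \<Rightarrow> plane" where
  "hex_corner c k = c + (cos (real k * pi / 3), sin (real k * pi / 3))"

definition hexagonal_lattice :: "nat \<Rightarrow> plane graph" where
  "hexagonal_lattice m =
     \<lparr>verts = {hex_corner c k | c k. c \<in> hex_centres m \<and> k < 6},
      edges = {{hex_corner c k, hex_corner c (Suc k)} | c k. c \<in> hex_centres m \<and> k < 6}\<rparr>"

definition square_lattices :: "plane graph set" where
  "square_lattices = {square_lattice n | n. n \<ge> 1}"

definition triangular_lattices :: "plane graph set" where
  "triangular_lattices = {triangular_lattice n | n. n \<ge> 1}"

definition hexagonal_lattices :: "plane graph set" where
  "hexagonal_lattices = {hexagonal_lattice m | m. m \<ge> 1}"

text \<open>Permutations of the vertex set are lists: \<open>\<sigma>\<^sub>i\<close> is \<open>\<sigma> ! (i - 1)\<close>, and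
  \<open>{\<sigma>\<^sub>1, \<dots>, \<sigma>\<^sub>t}\<close> is \<open>set (take t \<sigma>)\<close>.\<close>

abbreviation orders :: "'a graph \<Rightarrow> 'a list set" where
  "orders G \<equiv> permutations_of_set (verts G)"

definition num_components :: "'a graph \<Rightarrow> nat \<Rightarrow> 'a list \<Rightarrow> nat" where
  "num_components G t \<sigma> = card (components (induced G (set (take t \<sigma>))))"

definition expected_components :: "'a graph \<Rightarrow> ('a list \<Rightarrow> nat) \<Rightarrow> real" where
  "expected_components G \<tau> =
     1 / fact (card (verts G)) * (\<Sum>\<sigma>\<in>orders G. real (num_components G (\<tau> \<sigma>) \<sigma>))"

text \<open>A filtration is given by its \<open>\<sigma>\<close>-algebras, as families of subsets of \<^term>\<open>orders G\<close>
  indexed by time. Values of a stopping time outside \<^term>\<open>orders G\<close> are irrelevant.\<close>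

definition is_stopping_time ::
    "'a graph \<Rightarrow> (nat \<Rightarrow> 'a list set set) \<Rightarrow> ('a list \<Rightarrow> nat) \<Rightarrow> bool" where
  "is_stopping_time G P \<tau> \<longleftrightarrow>
     \<tau> \<in> orders G \<rightarrow> {1..card (verts G)} \<and>
     (\<forall>t\<in>{1..card (verts G)}. {\<sigma> \<in> orders G. \<tau> \<sigma> = t} \<in> P t)"

definition is_optimal ::
    "'a graph \<Rightarrow> (nat \<Rightarrow> 'a list set set) \<Rightarrow> ('a list \<Rightarrow> nat) \<Rightarrow> bool" where
  "is_optimal G P \<tau> \<longleftrightarrow>
     is_stopping_time G P \<tau> \<and>
     (\<forall>\<tau>'. is_stopping_time G P \<tau>' \<longrightarrow> expected_components G \<tau>' \<le> expected_components G \<tau>)"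

definition blind :: "'a graph \<Rightarrow> nat \<Rightarrow> 'a list set set" where
  "blind G t = {{}, orders G}"

definition full_information :: "'a graph \<Rightarrow> nat \<Rightarrow> 'a list set set" where
  "full_information G t =
     {A. A \<subseteq> orders G \<and> (\<forall>\<sigma>\<in>A. \<forall>\<pi>\<in>orders G. take t \<pi> = take t \<sigma> \<longrightarrow> \<pi> \<in> A)}"

definition normalized_value :: "'a graph \<Rightarrow> ('a list \<Rightarrow> nat) \<Rightarrow> real" where
  "normalized_value G \<tau> = 1 / real (card (verts G)) * expected_components G \<tau>"

end

theory Submission
  imports Defs
begin

text \<open>Write \<open>C\<close> for the number of components induced by the first \<open>t\<close> vertices.  The mean of \<open>C\<close> is
  trapped between two polynomials in \<open>p = t / N\<close>.  For the upper bound, each component is charged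
  to its vertex of least level (a linear functional of the position), so \<open>C\<close> is at most the number
  of present vertices from which none of a few fixed short paths to a lower vertex is fully present.
  For the lower bound, an edge whose ends are joined by a path of lower edges may be deleted, so
  \<open>C\<close> is at least the number of present vertices minus the number of present edges for which none of a
  few fixed detours is fully present.  Away from the boundary both counts are sums of translates of
  finitely many local events, and a set of \<open>k\<close> vertices is present with probability
  \<open>p ^ k + O(1 / N)\<close>.  For the full information game, transposing two entries of the permutation
  changes \<open>C\<close> by a bounded amount, hence \<open>C\<close> has variance \<open>O(N)\<close> and is uniformly close to its mean
  at a bounded number of times; between these times it increases by at most \<open>\<eta> N\<close>.\<close>

section \<open>Averages over permutations\<close>

text \<open>The blind value is a maximum over constant times. Its upper bound therefore needs a
  polynomial to be bounded on all of [0, 1], while its lower bound needs only one well-chosen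
  density. The detours come from Euler's formula, components = vertices - edges + bounded faces for
  a planar graph: the cycles used are faces of the lattice and the shortest cycles around a single
  vertex, each cancelling its edge of largest level. Larger holes need more vertices and are
  ignored. Near the boundary complete neighbourhoods are missing; no path is prescribed there, each
  vertex or edge is simply counted, and only O(sqrt N) of them occur. In the full information game
  the stopping time depends on the permutation, so bounds on the mean at each fixed time do not
  suffice. The deviation at a random control time is bounded by the sum of the deviations at all
  control times; as only an upper estimate is at stake, decreases between control times do no
  harm.\<close>

abbreviation swap :: "'a \<Rightarrow> 'a \<Rightarrow> 'a \<Rightarrow> 'a" where
  "swap \<equiv> Transposition.transpose"

definition perm_avg :: "'a set \<Rightarrow> ('a list \<Rightarrow> real) \<Rightarrow> real" where
  "perm_avg V f = (\<Sum>\<sigma>\<in>permutations_of_set V. f \<sigma>) / fact (card V)"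

lemma perm_avg_mono:
  assumes "\<And>\<sigma>. \<sigma> \<in> permutations_of_set V \<Longrightarrow> f \<sigma> \<le> g \<sigma>"
  shows "perm_avg V f \<le> perm_avg V g"
  unfolding perm_avg_def by (intro divide_right_mono sum_mono assms) auto

lemma perm_avg_cong:
  assumes "\<And>\<sigma>. \<sigma> \<in> permutations_of_set V \<Longrightarrow> f \<sigma> = g \<sigma>"
  shows "perm_avg V f = perm_avg V g"
  unfolding perm_avg_def by (simp add: assms cong: sum.cong)

lemma perm_avg_const [simp]: "finite V \<Longrightarrow> perm_avg V (\<lambda>_. c) = c"
  by (simp add: perm_avg_def)

lemma perm_avg_add: "perm_avg V (\<lambda>\<sigma>. f \<sigma> + g \<sigma>) = perm_avg V f + perm_avg V g"
  by (simp add: perm_avg_def sum.distrib add_divide_distrib)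

lemma perm_avg_diff: "perm_avg V (\<lambda>\<sigma>. f \<sigma> - g \<sigma>) = perm_avg V f - perm_avg V g"
  by (simp add: perm_avg_def sum_subtractf diff_divide_distrib)

lemma perm_avg_cmult: "perm_avg V (\<lambda>\<sigma>. c * f \<sigma>) = c * perm_avg V f"
  by (simp add: perm_avg_def sum_distrib_left[symmetric])

lemma perm_avg_sum: "perm_avg V (\<lambda>\<sigma>. \<Sum>i\<in>I. f i \<sigma>) = (\<Sum>i\<in>I. perm_avg V (f i))"
  unfolding perm_avg_def by (subst sum.swap) (simp add: sum_divide_distrib)

lemma perm_avg_abs_le: "\<bar>perm_avg V f\<bar> \<le> perm_avg V (\<lambda>\<sigma>. \<bar>f \<sigma>\<bar>)"
  unfolding perm_avg_def by (simp add: divide_right_mono sum_abs)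

lemma perm_avg_image:
  assumes "inj_on h V"
  shows "perm_avg (h ` V) f = perm_avg V (\<lambda>\<sigma>. f (map h \<sigma>))"
proof -
  have "inj_on (map h) (permutations_of_set V)"
  proof (rule inj_onI)
    fix xs ys assume "xs \<in> permutations_of_set V" "ys \<in> permutations_of_set V" "map h xs = map h ys"
    then show "xs = ys"
      using assms by (metis map_inj_on permutations_of_setD(1) sup.idem)
  qed
  then show ?thesis
    unfolding perm_avg_def permutations_of_set_image_inj[OF assms]
    by (simp add: sum.reindex card_image assms o_def)
qed

lemma perm_avg_transpose:
  assumes "a \<in> V" "b \<in> V"
  shows "perm_avg V (\<lambda>\<sigma>. f (map (swap a b) \<sigma>)) = perm_avg V f"
proof -
  have "swap a b ` V = V"
    using assms by simp
  then show ?thesis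
    using perm_avg_image[of "swap a b" V f] by simp
qed

text \<open>Conditioning on the first entry: given that it is \<open>x\<close>, the rest is a
  uniform permutation of \<open>V - {x}\<close>. This is the recursion behind the variance
  bound.\<close>

lemma perm_avg_Cons:
  assumes "finite V" "V \<noteq> {}"
  shows "perm_avg V f = (\<Sum>x\<in>V. perm_avg (V - {x}) (\<lambda>\<sigma>. f (x # \<sigma>))) / real (card V)"
proof -
  obtain n where n: "card V = Suc n"
    using assms by (metis card_gt_0_iff gr0_implies_Suc)
  define X where "X = (\<Sum>x\<in>V. perm_avg (V - {x}) (\<lambda>\<sigma>. f (x # \<sigma>)))"
  have "(\<Sum>\<sigma>\<in>permutations_of_set V. f \<sigma>)
      = (\<Sum>x\<in>V. \<Sum>\<sigma>\<in>(#) x ` permutations_of_set (V - {x}). f \<sigma>)"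
    unfolding permutations_of_set_nonempty[OF assms(2)]
    by (rule sum.UNION_disjoint) (use assms in auto)
  also have "\<dots> = (\<Sum>x\<in>V. \<Sum>\<sigma>\<in>permutations_of_set (V - {x}). f (x # \<sigma>))"
    by (simp add: sum.reindex o_def)
  also have "\<dots> = X * fact n"
    unfolding X_def sum_distrib_right perm_avg_def by (rule sum.cong) (use n assms in auto)
  finally show ?thesis
    unfolding X_def[symmetric] perm_avg_def[of V] by (simp add: n)
qed

text \<open>Revealing the permutation one entry at a time, each conditional expectation moves by at
  most \<open>c\<close>, since two choices of the next entry are coupled by a transposition.\<close>

lemma perm_avg_variance:
  assumes "finite V"
    and "\<And>\<sigma> a b. \<sigma> \<in> permutations_of_set V \<Longrightarrow> a \<in> V \<Longrightarrow> b \<in> V \<Longrightarrow>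
      \<bar>f (map (swap a b) \<sigma>) - f \<sigma>\<bar> \<le> c"
  shows "perm_avg V (\<lambda>\<sigma>. (f \<sigma> - perm_avg V f)\<^sup>2) \<le> real (card V) * c\<^sup>2"
  using assms
proof (induction "card V" arbitrary: V f)
  case 0
  then show ?case by (simp add: perm_avg_def)
next
  case (Suc n)
  have ne: "V \<noteq> {}" using Suc.hyps(2) by auto
  have card: "n = card (V - {x})" if "x \<in> V" for x
    using Suc.hyps(2) Suc.prems(1) that by simp
  define g where "g x = perm_avg (V - {x}) (\<lambda>\<sigma>. f (x # \<sigma>))" for x
  define m where "m = perm_avg V f"
  have m: "m = (\<Sum>x\<in>V. g x) / real (Suc n)"
    unfolding m_def g_def Suc.hyps(2) by (rule perm_avg_Cons[OF Suc.prems(1) ne])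
  have g_close: "\<bar>g x - g y\<bar> \<le> c" if x: "x \<in> V" and y: "y \<in> V" for x y
  proof -
    have "swap x y ` V = V"
      using x y by simp
    \<comment> \<open>The coupling: \<open>swap x y\<close> turns permutations starting with
      \<open>x\<close> into those starting with \<open>y\<close>, so the two conditional means
      differ by an average of effects of one swap.\<close>
    then have "swap x y ` (V - {x}) = V - {y}"
      by (simp add: image_set_diff)
    then have "g y = perm_avg (V - {x}) (\<lambda>\<sigma>. f (map (swap x y) (x # \<sigma>)))"
      unfolding g_def using perm_avg_image[of "swap x y" "V - {x}" "\<lambda>\<sigma>. f (y # \<sigma>)"] by simp
    then have "\<bar>g y - g x\<bar> \<le> perm_avg (V - {x})
        (\<lambda>\<sigma>. \<bar>f (map (swap x y) (x # \<sigma>)) - f (x # \<sigma>)\<bar>)"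
      unfolding g_def using perm_avg_abs_le[of "V - {x}"] by (simp flip: perm_avg_diff)
    also have "\<dots> \<le> perm_avg (V - {x}) (\<lambda>_. c)"
      by (rule perm_avg_mono, rule Suc.prems(2)[OF _ x y])
        (use x in \<open>auto simp: permutations_of_set_nonempty[OF ne]\<close>)
    finally show ?thesis
      using Suc.prems(1) by (simp add: abs_minus_commute)
  qed
  have gm: "\<bar>g x - m\<bar> \<le> c" if x: "x \<in> V" for x
  proof -
    have "g x - m = (\<Sum>y\<in>V. g x - g y) / real (Suc n)"
      unfolding m by (simp add: sum_subtractf field_simps flip: Suc.hyps(2))
    also have "\<bar>\<dots>\<bar> \<le> (\<Sum>y\<in>V. c) / real (Suc n)"
      unfolding abs_divide
      by (simp only: abs_of_nat)
        (intro divide_right_mono order.trans[OF sum_abs] sum_mono g_close x, simp_all)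
    also have "\<dots> = c"
      by (simp flip: Suc.hyps(2))
    finally show ?thesis .
  qed
  have "perm_avg (V - {x}) (\<lambda>\<sigma>. (f (x # \<sigma>) - m)\<^sup>2) \<le> real (Suc n) * c\<^sup>2" if x: "x \<in> V" for x
  proof -
    have var: "perm_avg (V - {x}) (\<lambda>\<sigma>. (f (x # \<sigma>) - g x)\<^sup>2) \<le> real n * c\<^sup>2"
      unfolding g_def card[OF x]
    proof (rule Suc.hyps(1)[OF card[OF x]])
      fix \<sigma> a b
      assume *: "\<sigma> \<in> permutations_of_set (V - {x})" "a \<in> V - {x}" "b \<in> V - {x}"
      have "x # \<sigma> \<in> permutations_of_set V"
        using * x by (auto simp: permutations_of_set_nonempty[OF ne])
      moreover have "map (swap a b) (x # \<sigma>) = x # map (swap a b) \<sigma>"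
        using * by auto
      ultimately show "\<bar>f (x # map (swap a b) \<sigma>) - f (x # \<sigma>)\<bar> \<le> c"
        using * Suc.prems(2)[of "x # \<sigma>" a b] by simp
    qed (use Suc.prems(1) in auto)
    \<comment> \<open>Expansion around the conditional mean \<open>g x\<close>: the cross term
      averages to zero, the first square is covered by the induction hypothesis, and the last one
      adds at most \<open>c\<^sup>2\<close>.\<close>
    have "perm_avg (V - {x}) (\<lambda>\<sigma>. (f (x # \<sigma>) - m)\<^sup>2)
        = perm_avg (V - {x}) (\<lambda>\<sigma>. (f (x # \<sigma>) - g x)\<^sup>2 + (2 * (g x - m) * (f (x # \<sigma>) - g x) + (g x - m)\<^sup>2))"
      by (rule perm_avg_cong) (simp add: power2_eq_square algebra_simps)
    also have "\<dots> = perm_avg (V - {x}) (\<lambda>\<sigma>. (f (x # \<sigma>) - g x)\<^sup>2) + (g x - m)\<^sup>2"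
      unfolding perm_avg_add perm_avg_cmult perm_avg_diff
      using Suc.prems(1) by (simp add: g_def)
    also have "(g x - m)\<^sup>2 \<le> c\<^sup>2"
      using gm[OF x] by (simp add: abs_le_square_iff[symmetric])
    finally show ?thesis
      using var by (simp add: algebra_simps)
  qed
  then have "(\<Sum>x\<in>V. perm_avg (V - {x}) (\<lambda>\<sigma>. (f (x # \<sigma>) - m)\<^sup>2)) \<le> (\<Sum>x\<in>V. real (Suc n) * c\<^sup>2)"
    by (rule sum_mono)
  then show ?case
    unfolding m_def[symmetric] perm_avg_Cons[OF Suc.prems(1) ne, of "\<lambda>\<sigma>. (f \<sigma> - m)\<^sup>2"]
    by (simp add: field_simps flip: Suc.hyps(2))
qed

text \<open>The inequality \<open>\<bar>h\<bar> \<le> h\<^sup>2 / s + s\<close> with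
  \<open>s\<close> the square root of \<open>card V\<close> balances both terms. First moments are
  what is wanted, since deviations at several times get added.\<close>

lemma perm_avg_deviation:
  assumes "finite V" "V \<noteq> {}"
    and "\<And>\<sigma> a b. \<sigma> \<in> permutations_of_set V \<Longrightarrow> a \<in> V \<Longrightarrow> b \<in> V \<Longrightarrow>
      \<bar>f (map (swap a b) \<sigma>) - f \<sigma>\<bar> \<le> c"
  shows "perm_avg V (\<lambda>\<sigma>. \<bar>f \<sigma> - perm_avg V f\<bar>) \<le> (c\<^sup>2 + 1) * sqrt (card V)"
proof -
  define s where "s = sqrt (card V)"
  have s: "s > 0" "s\<^sup>2 = card V"
    using assms(1,2) by (auto simp: s_def card_gt_0_iff)
  have amgm: "\<bar>h\<bar> \<le> (1 / s) * h\<^sup>2 + s" for h :: real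
  proof -
    have "0 \<le> (\<bar>h\<bar> - s)\<^sup>2 + s * \<bar>h\<bar>"
      using s by simp
    then have "s * \<bar>h\<bar> \<le> h\<^sup>2 + s\<^sup>2"
      by (simp add: power2_eq_square algebra_simps)
    then show ?thesis
      using s by (simp add: field_simps power2_eq_square)
  qed
  have "perm_avg V (\<lambda>\<sigma>. \<bar>f \<sigma> - perm_avg V f\<bar>)
      \<le> perm_avg V (\<lambda>\<sigma>. (1 / s) * (f \<sigma> - perm_avg V f)\<^sup>2 + s)"
    by (intro perm_avg_mono amgm)
  also have "\<dots> = (1 / s) * perm_avg V (\<lambda>\<sigma>. (f \<sigma> - perm_avg V f)\<^sup>2) + s"
    unfolding perm_avg_add perm_avg_cmult using assms(1) by simp
  also have "\<dots> \<le> (1 / s) * (s\<^sup>2 * c\<^sup>2) + s"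
    using perm_avg_variance[OF assms(1,3)] s by (simp add: divide_right_mono)
  also have "\<dots> = (c\<^sup>2 + 1) * s"
    using s by (simp add: power2_eq_square field_simps)
  finally show ?thesis by (simp add: s_def)
qed

section \<open>Probability that a fixed set is present at time \<open>t\<close>\<close>

abbreviation first :: "nat \<Rightarrow> 'a list \<Rightarrow> 'a set" where
  "first t \<sigma> \<equiv> set (take t \<sigma>)"

lemma card_first:
  assumes "\<sigma> \<in> permutations_of_set V" "t \<le> card V"
  shows "card (first t \<sigma>) = t" "first t \<sigma> \<subseteq> V"
proof -
  have "distinct \<sigma>" "set \<sigma> = V" "length \<sigma> = card V"
    using assms(1) by (auto simp: permutations_of_setD distinct_card[symmetric])
  then show "card (first t \<sigma>) = t" "first t \<sigma> \<subseteq> V"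
    using assms(2) by (auto simp: distinct_card dest: in_set_takeD)
qed

definition contain_prob :: "'a set \<Rightarrow> nat \<Rightarrow> 'a set \<Rightarrow> real" where
  "contain_prob V t A = perm_avg V (\<lambda>\<sigma>. of_bool (A \<subseteq> first t \<sigma>))"

lemma contain_prob_bounds:
  assumes "finite V"
  shows "0 \<le> contain_prob V t A" "contain_prob V t A \<le> 1"
proof -
  have "perm_avg V (\<lambda>_. 0) \<le> contain_prob V t A" "contain_prob V t A \<le> perm_avg V (\<lambda>_. 1)"
    unfolding contain_prob_def by (intro perm_avg_mono; simp)+
  then show "0 \<le> contain_prob V t A" "contain_prob V t A \<le> 1"
    using assms by simp_all
qed

text \<open>By symmetry, the points outside \<open>A\<close> share the \<open>t - card A\<close> remaining places equally.\<close>

lemma contain_prob_insert: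
  assumes "finite V" "t \<le> card V" "A \<subseteq> V" "x \<in> V - A"
  shows "(real (card V) - card A) * contain_prob V t (insert x A)
    = (real t - card A) * contain_prob V t A"
proof -
  have eq: "contain_prob V t (insert y A) = contain_prob V t (insert x A)" if y: "y \<in> V - A" for y
  proof -
    have im: "swap x y ` insert x A = insert y A"
    proof -
      have "swap x y ` A = A"
        using y assms(4) by (intro transpose_image_eq) auto
      then show ?thesis by simp
    qed
    have "insert y A \<subseteq> first t (map (swap x y) \<sigma>) \<longleftrightarrow> insert x A \<subseteq> first t \<sigma>" for \<sigma>
      unfolding im[symmetric] take_map set_map
      by (rule inj_image_subset_iff) simp
    then have "contain_prob V t (insert x A)
        = perm_avg V (\<lambda>\<sigma>. of_bool (insert y A \<subseteq> first t (map (swap x y) \<sigma>)))"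
      unfolding contain_prob_def by (simp only:)
    also have "\<dots> = contain_prob V t (insert y A)"
      unfolding contain_prob_def
      using perm_avg_transpose[of x V y "\<lambda>\<sigma>. of_bool (insert y A \<subseteq> first t \<sigma>)"] y assms(4)
      by (simp only: Diff_iff)
    finally show ?thesis ..
  qed
  have fin: "finite A" using assms finite_subset by blast
  \<comment> \<open>Double counting: if \<open>A\<close> is present, exactly
    \<open>t - card A\<close> further points are present.\<close>
  have pt: "(\<Sum>y\<in>V - A. of_bool (insert y A \<subseteq> first t \<sigma>)) = (real t - card A) * of_bool (A \<subseteq> first t \<sigma>)"
    if \<sigma>: "\<sigma> \<in> permutations_of_set V" for \<sigma>
  proof (cases "A \<subseteq> first t \<sigma>")
    case True
    have "(\<Sum>y\<in>V - A. of_bool (insert y A \<subseteq> first t \<sigma>)) = real (card ((V - A) \<inter> {y. insert y A \<subseteq> first t \<sigma>}))"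
      using assms(1) by simp
    also have "(V - A) \<inter> {y. insert y A \<subseteq> first t \<sigma>} = first t \<sigma> - A"
      using True card_first[OF \<sigma> assms(2)] by auto
    also have "card (first t \<sigma> - A) = t - card A"
      using card_first[OF \<sigma> assms(2)] True fin by (simp add: card_Diff_subset)
    also have "real (t - card A) = real t - card A"
      using card_mono[OF _ True] card_first[OF \<sigma> assms(2)] by (simp add: of_nat_diff)
    finally show ?thesis using True by simp
  qed auto
  have "(real (card V) - card A) * contain_prob V t (insert x A) = (\<Sum>y\<in>V - A. contain_prob V t (insert y A))"
  proof -
    have "(\<Sum>y\<in>V - A. contain_prob V t (insert y A)) = (\<Sum>y\<in>V - A. contain_prob V t (insert x A))"
      by (intro sum.cong eq refl)
    then show ?thesis
      using assms fin by (simp add: card_Diff_subset card_mono of_nat_diff)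
  qed
  also have "\<dots> = perm_avg V (\<lambda>\<sigma>. (real t - card A) * of_bool (A \<subseteq> first t \<sigma>))"
    unfolding contain_prob_def perm_avg_sum[symmetric] by (rule perm_avg_cong) (rule pt)
  finally show ?thesis
    by (simp add: perm_avg_cmult contain_prob_def)
qed

lemma contain_prob_approx:
  assumes "finite V" "t \<le> card V" "A \<subseteq> V" "card A \<le> K" "2 * K \<le> card V" "0 < K"
  shows "\<bar>contain_prob V t A - (t / card V) ^ card A\<bar> \<le> card A * (2 * real K / card V)"
proof -
  have "finite A" using assms finite_subset by blast
  then show ?thesis using assms(3,4)
  proof (induction A)
    case empty
    then show ?case using assms(1) by (simp add: contain_prob_def)
  next
    case (insert x A)
    define N p k where "N = real (card V)" and "p = t / N" and "k = real (card A)"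
    have k: "k + 1 \<le> K" "0 \<le> k" and N: "2 * K \<le> N" "N > 0" "t \<le> N"
      using insert assms by (auto simp: k_def N_def)
    have p: "0 \<le> p" "p \<le> 1"
      using N by (auto simp: p_def N_def)
    \<comment> \<open>The conditional probability that \<open>x\<close> is present, given
      \<open>A\<close>. It falls short of \<open>p\<close> by at most \<open>2 * K / N\<close>
      because \<open>N - k\<close> is at least \<open>N / 2\<close>.\<close>
    define q where "q = (t - k) / (N - k)"
    have step: "contain_prob V t (insert x A) = q * contain_prob V t A"
      using contain_prob_insert[OF assms(1,2), of A x] insert k N
      by (simp add: q_def N_def k_def field_simps)
    have "p - q = k * (N - t) / (N * (N - k))"
      using N k by (simp add: p_def q_def N_def[symmetric] field_simps)
    moreover have "0 \<le> k * (N - t) / (N * (N - k))"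
      using N k by (intro divide_nonneg_nonneg mult_nonneg_nonneg) auto
    moreover have "k * (N - t) / (N * (N - k)) \<le> 2 * real K / N"
    proof -
      have "k * (N - t) \<le> K * N"
        by (intro mult_mono) (use k N in auto)
      also have "\<dots> \<le> K * (2 * (N - k))"
        by (intro mult_left_mono) (use k N in auto)
      finally have "k * (N - t) / (N - k) \<le> 2 * K"
        using N k by (simp add: pos_divide_le_eq mult_ac)
      then have "k * (N - t) / (N - k) / N \<le> 2 * real K / N"
        using N by (intro divide_right_mono) auto
      then show ?thesis by (simp add: mult.commute)
    qed
    ultimately have pq: "\<bar>p - q\<bar> \<le> 2 * real K / N" by linarith
    have "\<bar>contain_prob V t A * (q - p)\<bar> \<le> 1 * (2 * real K / N)"
      unfolding abs_mult using pq contain_prob_bounds[OF assms(1), of t A] N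
      by (intro mult_mono) auto
    moreover have "\<bar>p * (contain_prob V t A - p ^ card A)\<bar> \<le> 1 * (k * (2 * real K / N))"
      unfolding abs_mult using insert p
      by (intro mult_mono) (auto simp: k_def N_def p_def)
    moreover have "contain_prob V t (insert x A) - p ^ card (insert x A)
        = contain_prob V t A * (q - p) + p * (contain_prob V t A - p ^ card A)"
      using insert step by (simp add: algebra_simps)
    moreover have "real (card (insert x A)) * (2 * real K / N) = k * (2 * real K / N) + 2 * real K / N"
      using insert by (simp add: k_def algebra_simps add_divide_distrib)
    ultimately show ?case
      unfolding N_def[symmetric] p_def[symmetric] by linarith
  qed
qed

text \<open>The probability, when every point is present independently with probability \<open>p\<close>, that all of
  \<open>A\<close> and none of the sets in the list is present.\<close>

fun avoid_poly :: "'a set \<Rightarrow> 'a set list \<Rightarrow> real \<Rightarrow> real" where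
  "avoid_poly A [] p = p ^ card A"
| "avoid_poly A (Q # Qs) p = avoid_poly A Qs p - avoid_poly (A \<union> Q) Qs p"

abbreviation avoids :: "'a set \<Rightarrow> 'a set list \<Rightarrow> 'a set \<Rightarrow> bool" where
  "avoids A Qs W \<equiv> A \<subseteq> W \<and> (\<forall>Q\<in>set Qs. \<not> Q \<subseteq> W)"

text \<open>Inclusion-exclusion: each set in the list splits the event into a difference of two,
  which leaves \<open>2 ^ length Qs\<close> events of the form that at most \<open>K\<close> given
  points are present, each with an error of at most \<open>2 * K\<^sup>2 / N\<close>.\<close>

lemma avoid_poly_approx:
  assumes "finite V" "t \<le> card V" "A \<union> \<Union>(set Qs) \<subseteq> V" "card (A \<union> \<Union>(set Qs)) \<le> K"
    "2 * K \<le> card V" "0 < K"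
  shows "\<bar>perm_avg V (\<lambda>\<sigma>. of_bool (avoids A Qs (first t \<sigma>))) - avoid_poly A Qs (t / card V)\<bar>
    \<le> 2 ^ length Qs * (2 * (real K)\<^sup>2 / card V)"
  using assms(3,4)
proof (induction Qs arbitrary: A)
  case Nil
  have "card A * (2 * real K / card V) \<le> K * (2 * real K / card V)"
    using Nil by (intro mult_right_mono) auto
  also have "\<dots> = 2 * (real K)\<^sup>2 / card V"
    by (simp add: power2_eq_square)
  finally show ?case
    using contain_prob_approx[OF assms(1,2), of A K] Nil assms(5,6)
    by (simp add: contain_prob_def)
next
  case (Cons Q Qs)
  have "card (A \<union> \<Union>(set Qs)) \<le> card (A \<union> \<Union>(set (Q # Qs)))"
    using Cons.prems assms(1) finite_subset by (intro card_mono) auto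
  then have 1: "\<bar>perm_avg V (\<lambda>\<sigma>. of_bool (avoids A Qs (first t \<sigma>))) - avoid_poly A Qs (t / card V)\<bar>
      \<le> 2 ^ length Qs * (2 * (real K)\<^sup>2 / card V)"
    using Cons.prems by (intro Cons.IH) auto
  have 2: "\<bar>perm_avg V (\<lambda>\<sigma>. of_bool (avoids (A \<union> Q) Qs (first t \<sigma>))) - avoid_poly (A \<union> Q) Qs (t / card V)\<bar>
      \<le> 2 ^ length Qs * (2 * (real K)\<^sup>2 / card V)"
    using Cons.prems by (intro Cons.IH) (auto simp: Un_assoc)
  have "perm_avg V (\<lambda>\<sigma>. of_bool (avoids A (Q # Qs) (first t \<sigma>)))
      = perm_avg V (\<lambda>\<sigma>. of_bool (avoids A Qs (first t \<sigma>)) - of_bool (avoids (A \<union> Q) Qs (first t \<sigma>)))"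
    by (rule perm_avg_cong) auto
  then show ?case
    using 1 2 by (simp add: perm_avg_diff)
qed

section \<open>Components and edges\<close>

definition conn :: "'a set set \<Rightarrow> ('a \<times> 'a) set" where
  "conn E = {(u, v). {u, v} \<in> E}\<^sup>*"

text \<open>The relation \<open>conn E\<close> is reflexive on the whole type, so a vertex on no
  edge is a class of its own. Keeping \<open>V\<close> and \<open>E\<close> separate lets edges be
  added or deleted over a fixed vertex set.\<close>

definition ncomp :: "'a set \<Rightarrow> 'a set set \<Rightarrow> nat" where
  "ncomp V E = card (V // conn E)"

lemma equiv_conn: "equiv UNIV (conn E)"
  unfolding conn_def
  by (intro equivI refl_rtrancl trans_rtrancl sym_rtrancl symI) (auto simp: insert_commute)

lemma conn_refl [simp]: "(x, x) \<in> conn E"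
  by (simp add: conn_def)

lemma conn_sym: "(x, y) \<in> conn E \<Longrightarrow> (y, x) \<in> conn E"
  using equiv_conn by (metis equivE symD)

lemma conn_trans: "(x, y) \<in> conn E \<Longrightarrow> (y, z) \<in> conn E \<Longrightarrow> (x, z) \<in> conn E"
  unfolding conn_def by (rule rtrancl_trans)

lemma conn_edge: "{x, y} \<in> E \<Longrightarrow> (x, y) \<in> conn E"
  unfolding conn_def by auto

lemma conn_mono: "E \<subseteq> E' \<Longrightarrow> conn E \<subseteq> conn E'"
  unfolding conn_def by (intro rtrancl_mono) auto

lemma conn_closed:
  assumes "(x, y) \<in> conn E" "x \<in> V" "\<Union>E \<subseteq> V"
  shows "y \<in> V"
  using assms(1) unfolding conn_def
  by (induction rule: rtrancl_induct) (use assms(2,3) in auto)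

lemma conn_class_eq: "conn E `` {x} = conn E `` {y} \<longleftrightarrow> (x, y) \<in> conn E"
  using eq_equiv_class_iff[OF equiv_conn] by simp

text \<open>A walk can be shortened to use the new edge at most once, in one of its two
  directions.\<close>

lemma conn_insert:
  assumes "(x, y) \<in> conn (insert {u, w} E)"
  shows "(x, y) \<in> conn E \<or> (x, u) \<in> conn E \<and> (w, y) \<in> conn E \<or> (x, w) \<in> conn E \<and> (u, y) \<in> conn E"
  using assms unfolding conn_def[of "insert _ _"]
proof (induction rule: rtrancl_induct)
  case (step y z)
  consider "(y, z) \<in> conn E" | "y = u" "z = w" | "y = w" "z = u"
    using step(2) by (auto simp: doubleton_eq_iff intro: conn_edge)
  then show ?case
    using step(3) by cases (auto intro: conn_trans conn_sym)
qed simp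

lemma ncomp_antimono:
  assumes "finite V" "E \<subseteq> E'"
  shows "ncomp V E' \<le> ncomp V E"
proof -
  have "conn E' `` (conn E `` {x}) = conn E' `` {x}" for x
    using conn_mono[OF assms(2)] conn_trans[of x _ E'] by (fastforce simp: Image_def)
  then have "V // conn E' = (\<lambda>c. conn E' `` c) ` (V // conn E)"
    by (auto simp: quotient_def image_iff)
  moreover have "finite (V // conn E)"
    using assms(1) by (auto simp: quotient_def)
  ultimately show ?thesis
    unfolding ncomp_def by (simp add: card_image_le)
qed

text \<open>Only the classes of \<open>u\<close> and \<open>w\<close> can merge, so once the class
  of \<open>u\<close> is discarded, the map from old to new classes is injective.\<close>

lemma ncomp_insert_edge:
  assumes "finite V"
  shows "ncomp V E \<le> ncomp V (insert {u, w} E) + 1"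
proof -
  let ?E' = "insert {u, w} E"
  have im: "conn ?E' `` (conn E `` {x}) = conn ?E' `` {x}" for x
    using conn_mono[of E ?E'] conn_trans[of x _ ?E'] by (fastforce simp: Image_def)
  have fin: "finite (V // conn E)" "finite (V // conn ?E')"
    using assms by (auto simp: quotient_def)
  have "inj_on (\<lambda>c. conn ?E' `` c) (V // conn E - {conn E `` {u}})"
  proof (rule inj_onI)
    fix c d
    assume c: "c \<in> V // conn E - {conn E `` {u}}" and d: "d \<in> V // conn E - {conn E `` {u}}"
      and eq: "conn ?E' `` c = conn ?E' `` d"
    obtain x y where xy: "c = conn E `` {x}" "d = conn E `` {y}"
      using c d by (auto simp: quotient_def)
    have "(x, y) \<in> conn ?E'"
      using eq unfolding xy im conn_class_eq .
    moreover have "(x, u) \<notin> conn E" "(y, u) \<notin> conn E"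
      using c d unfolding xy conn_class_eq[symmetric] by blast+
    ultimately show "c = d"
      unfolding xy conn_class_eq using conn_insert[of x y u w E] conn_sym[of u y E] by blast
  qed
  moreover have "(\<lambda>c. conn ?E' `` c) ` (V // conn E - {conn E `` {u}}) \<subseteq> V // conn ?E'"
    by (auto simp: quotient_def im simp del: Image_singleton_iff)
  ultimately have "card (V // conn E - {conn E `` {u}}) \<le> ncomp V ?E'"
    unfolding ncomp_def by (rule card_inj_on_le) (rule fin)
  moreover have diff1: "card A \<le> card (A - {c}) + 1" for A :: "'a set set" and c
    by (cases "card A") (simp_all add: card_Diff_singleton_if)
  ultimately show ?thesis
    unfolding ncomp_def using diff1[of "V // conn E" "conn E `` {u}"] by linarith
qed

lemma ncomp_union:
  assumes "finite V" "finite F" "\<And>e. e \<in> F \<Longrightarrow> \<exists>u w. e = {u, w}"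
  shows "ncomp V E \<le> ncomp V (E \<union> F) + card F"
  using assms(2,3)
proof (induction F)
  case (insert e F)
  obtain u w where "e = {u, w}" using insert.prems by blast
  then show ?case
    using insert ncomp_insert_edge[OF assms(1), of "E \<union> F" u w] by simp
qed simp

lemma ncomp_insert_vertex:
  assumes "finite V" "x \<notin> V" "\<Union>E \<subseteq> V"
  shows "ncomp (insert x V) E = ncomp V E + 1"
proof -
  have "conn E `` {x} = {x}"
  proof -
    have "y = x" if "(x, y) \<in> conn E" for y
      using that unfolding conn_def
      by (induction rule: rtrancl_induct) (use assms in auto)
    then show ?thesis by auto
  qed
  then have "insert x V // conn E = insert {x} (V // conn E)"
    by (auto simp: quotient_def)
  moreover have "{x} \<notin> V // conn E"
    using assms(2) by (auto simp: quotient_def)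
  moreover have "finite (V // conn E)"
    using assms(1) by (auto simp: quotient_def)
  ultimately show ?thesis by (simp add: ncomp_def)
qed

lemma ncomp_no_edges: "finite V \<Longrightarrow> ncomp V {} = card V"
  by (induction V rule: finite_induct) (simp_all add: ncomp_insert_vertex, simp add: ncomp_def)

text \<open>Starting from isolated vertices, each inserted edge lowers the number of components by
  at most one.\<close>

lemma card_le_ncomp:
  assumes "finite V" "finite E" "\<And>e. e \<in> E \<Longrightarrow> \<exists>u w. e = {u, w}"
  shows "card V \<le> ncomp V E + card E"
  using ncomp_union[OF assms, of "{}"] by (simp add: ncomp_no_edges assms)

lemma conn_successively:
  assumes "successively (\<lambda>x y. (x, y) \<in> conn E) p" "p \<noteq> []"
  shows "(hd p, last p) \<in> conn E"
  using assms
proof (induction p)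
  case (Cons x p)
  then show ?case
    by (cases p) (auto intro: conn_trans)
qed simp

definition ncomp_in :: "'a graph \<Rightarrow> 'a set \<Rightarrow> nat" where
  "ncomp_in G W = card (components (induced G W))"

locale bounded_degree_graph =
  fixes G :: "'a graph" and D :: nat
  assumes finite_verts: "finite (verts G)"
    and edge_ends: "e \<in> edges G \<Longrightarrow> \<exists>u\<in>verts G. \<exists>w\<in>verts G. e = {u, w}"
    and degree_le: "x \<in> verts G \<Longrightarrow> card {e \<in> edges G. x \<in> e} \<le> D"
begin

lemma finite_edges: "finite (edges G)"
proof (rule finite_subset)
  show "edges G \<subseteq> Pow (verts G)" using edge_ends by auto
qed (simp add: finite_verts)

lemma ncomp_in_eq: "W \<subseteq> verts G \<Longrightarrow> ncomp_in G W = ncomp W {e \<in> edges G. e \<subseteq> W}"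
  by (simp add: ncomp_in_def components_def induced_def ncomp_def conn_def Int_absorb1)

text \<open>First \<open>x\<close> is added as an isolated vertex, which gives one more component;
  then its at most \<open>D\<close> edges follow, each costing at most one component.\<close>

lemma ncomp_in_insert:
  assumes "W \<subseteq> verts G" "x \<in> verts G - W"
  shows "ncomp_in G (insert x W) \<le> ncomp_in G W + 1"
    and "ncomp_in G W + 1 \<le> ncomp_in G (insert x W) + D"
proof -
  let ?E = "{e \<in> edges G. e \<subseteq> W}"
  let ?F = "{e \<in> edges G. e \<subseteq> insert x W \<and> x \<in> e}"
  have fin: "finite W" using assms(1) finite_verts finite_subset by blast
  have E: "{e \<in> edges G. e \<subseteq> insert x W} = ?E \<union> ?F"
    using assms by blast
  have new: "ncomp (insert x W) ?E = ncomp_in G W + 1"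
    using ncomp_insert_vertex[of W x ?E] assms fin by (auto simp: ncomp_in_eq)
  have sub: "insert x W \<subseteq> verts G" using assms by auto
  show "ncomp_in G (insert x W) \<le> ncomp_in G W + 1"
    unfolding ncomp_in_eq[OF sub] E using ncomp_antimono[of "insert x W" ?E "?E \<union> ?F"] new fin by simp
  have "ncomp (insert x W) ?E \<le> ncomp (insert x W) (?E \<union> ?F) + card ?F"
  proof (rule ncomp_union)
    show "finite ?F" using finite_edges by simp
    show "\<exists>u w. e = {u, w}" if "e \<in> ?F" for e
      using that edge_ends[of e] by blast
  qed (use fin in simp)
  moreover have "card ?F \<le> card {e \<in> edges G. x \<in> e}"
    using finite_edges by (intro card_mono) auto
  ultimately show "ncomp_in G W + 1 \<le> ncomp_in G (insert x W) + D"
    unfolding ncomp_in_eq[OF sub] E using new degree_le[of x] assms by simp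
qed

lemma ncomp_in_union:
  assumes "W \<union> X \<subseteq> verts G"
  shows "ncomp_in G (W \<union> X) \<le> ncomp_in G W + card X"
proof -
  have "finite X" using assms finite_verts finite_subset by blast
  then show ?thesis using assms
  proof (induction X)
    case (insert x X)
    show ?case
    proof (cases "x \<in> W")
      case True
      then show ?thesis using insert by (simp add: insert_absorb)
    next
      case False
      then show ?thesis
        using insert ncomp_in_insert(1)[of "W \<union> X" x] by simp
    qed
  qed simp
qed

text \<open>If the set changes at all, one point is exchanged for another. Both sets then extend a
  common set \<open>X\<close> by one vertex, so both counts lie between
  \<open>ncomp_in G X + 1 - D\<close> and \<open>ncomp_in G X + 1\<close>.\<close>

lemma ncomp_in_swap:
  assumes "W \<subseteq> verts G" "a \<in> verts G" "b \<in> verts G"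
  shows "\<bar>real (ncomp_in G (swap a b ` W)) - real (ncomp_in G W)\<bar> \<le> real D"
proof -
  have exchange: "\<bar>real (ncomp_in G (insert y X)) - real (ncomp_in G (insert x X))\<bar> \<le> real D"
    if "X \<subseteq> verts G" "x \<in> verts G - X" "y \<in> verts G - X" for x y X
    using ncomp_in_insert[OF that(1,2)] ncomp_in_insert[OF that(1,3)] by linarith
  consider "a \<in> W \<longleftrightarrow> b \<in> W" | "a \<in> W" "b \<notin> W" | "b \<in> W" "a \<notin> W" by blast
  then show ?thesis
  proof cases
    case 1
    then show ?thesis by simp
  next
    case 2
    then have "W = insert a (W - {a})" "swap a b ` W = insert b (W - {a})"
      by (auto simp: Transposition.transpose_def image_iff)
    then show ?thesis using exchange[of "W - {a}" a b] 2 assms by auto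
  next
    case 3
    then have "W = insert b (W - {b})" "swap a b ` W = insert a (W - {b})"
      by (auto simp: Transposition.transpose_def image_iff)
    then show ?thesis using exchange[of "W - {b}" b a] 3 assms by auto
  qed
qed

text \<open>Every component has a vertex of least rank, and no such vertex starts one of the given
  rank-decreasing paths.\<close>

lemma ncomp_in_upper:
  fixes r :: "'a \<Rightarrow> real"
  assumes W: "W \<subseteq> verts G"
    and P: "\<And>v p. v \<in> verts G \<Longrightarrow> p \<in> set (P v) \<Longrightarrow>
      p \<noteq> [] \<and> successively (\<lambda>x y. {x, y} \<in> edges G) (v # p) \<and> r (last p) < r v"
  shows "ncomp_in G W \<le> card {v \<in> verts G. avoids {v} (map set (P v)) W}"
proof -
  let ?E = "{e \<in> edges G. e \<subseteq> W}"
  let ?M = "{v \<in> verts G. avoids {v} (map set (P v)) W}"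
  have fin: "finite W" using W finite_verts finite_subset by blast
  have "c \<in> (\<lambda>v. conn ?E `` {v}) ` ?M" if c: "c \<in> W // conn ?E" for c
  proof -
    obtain x where x: "x \<in> W" "c = conn ?E `` {x}" using c by (auto simp: quotient_def)
    have "c \<subseteq> W" using x conn_closed[of x _ ?E W] by auto
    have "x \<in> c" using x by simp
    have "finite c" "c \<noteq> {}" using finite_subset[OF \<open>c \<subseteq> W\<close> fin] \<open>x \<in> c\<close> by blast+
    then obtain v where v: "v \<in> c" "\<And>y. y \<in> c \<Longrightarrow> r v \<le> r y"
      by (metis arg_min_if_finite(1) arg_min_least)
    have vW: "v \<in> W" using \<open>c \<subseteq> W\<close> v by blast
    have cv: "c = conn ?E `` {v}" using v(1) unfolding x(2) conn_class_eq by simp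
    have "\<not> set p \<subseteq> W" if p: "p \<in> set (P v)" for p
    proof
      assume "set p \<subseteq> W"
      note Pv = P[OF subsetD[OF W vW] p]
      have "successively (\<lambda>x y. (x, y) \<in> conn ?E) (v # p)"
        by (rule successively_mono[OF conjunct1[OF conjunct2[OF Pv]]])
          (use \<open>set p \<subseteq> W\<close> vW in \<open>auto intro: conn_edge\<close>)
      then have "last p \<in> c"
        using conn_successively[of ?E "v # p"] Pv by (simp add: cv)
      then show False using v(2) Pv by force
    qed
    then have "v \<in> ?M" using vW W by auto
    then show ?thesis using cv by blast
  qed
  then have "W // conn ?E \<subseteq> (\<lambda>v. conn ?E `` {v}) ` ?M" by blast
  then have "card (W // conn ?E) \<le> card ?M"
    using finite_verts by (intro surj_card_le) auto
  then show ?thesis by (simp add: ncomp_in_eq[OF W] ncomp_def)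
qed

text \<open>Deleting every edge whose ends are joined by a path of edges of smaller rank does not
  change the components.\<close>

lemma ncomp_in_lower:
  fixes r :: "'a set \<Rightarrow> real" and I :: "'i set"
  assumes W: "W \<subseteq> verts G" and I: "finite I" "edges G \<subseteq> ed ` I"
    and P: "\<And>i p. i \<in> I \<Longrightarrow> p \<in> set (P i) \<Longrightarrow> p \<noteq> [] \<and> ed i = {hd p, last p} \<and>
      successively (\<lambda>x y. {x, y} \<in> edges G \<and> r {x, y} < r (ed i)) p"
  shows "card W \<le> ncomp_in G W + card {i \<in> I. avoids (ed i) (map set (P i)) W}"
proof -
  let ?E = "{e \<in> edges G. e \<subseteq> W}"
  define J where "J = {i \<in> I. ed i \<in> edges G \<and> avoids (ed i) (map set (P i)) W}"
  have fin: "finite W" using W finite_verts finite_subset by blast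
  have "(x, y) \<in> conn (ed ` J)" if "{x, y} \<in> ?E" for x y
    using that
  \<comment> \<open>Ranks are real numbers, so the induction runs on the number of edges of smaller
    rank; it drops strictly for the edges of a detour.\<close>
  proof (induction "card {e \<in> edges G. r e < r {x, y}}" arbitrary: x y rule: less_induct)
    case less
    obtain i where i: "i \<in> I" "ed i = {x, y}" using less.prems I by auto
    show ?case
    proof (cases "i \<in> J")
      case True
      then show ?thesis using i by (intro conn_edge) force
    next
      case False
      \<comment> \<open>An edge present in \<open>W\<close> is missing from \<open>J\<close> only
        because one of its detours is fully present.\<close>
      then obtain p where p: "p \<in> set (P i)" "set p \<subseteq> W"
        using i less.prems by (auto simp: J_def)
      note Pi = P[OF i(1) p(1)]
      have "successively (\<lambda>x y. (x, y) \<in> conn (ed ` J)) p"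
      proof (rule successively_mono[OF conjunct2[OF conjunct2[OF Pi]]])
        fix u w assume *: "u \<in> set p" "w \<in> set p" "{u, w} \<in> edges G \<and> r {u, w} < r (ed i)"
        then have "{e \<in> edges G. r e < r {u, w}} \<subset> {e \<in> edges G. r e < r {x, y}}"
          using i less.prems by auto
        then have "card {e \<in> edges G. r e < r {u, w}} < card {e \<in> edges G. r e < r {x, y}}"
          using finite_edges by (intro psubset_card_mono) auto
        then show "(u, w) \<in> conn (ed ` J)"
          using * p by (intro less.hyps) auto
      qed
      then have "(hd p, last p) \<in> conn (ed ` J)"
        using Pi by (intro conn_successively) auto
      then show ?thesis
        using Pi i by (auto simp: doubleton_eq_iff intro: conn_sym)
    qed
  qed
  then have "conn ?E \<subseteq> conn (ed ` J)"
    unfolding conn_def by (intro rtrancl_subset_rtrancl) auto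
  moreover have "conn (ed ` J) \<subseteq> conn ?E"
    by (intro conn_mono) (auto simp: J_def)
  ultimately have "ncomp_in G W = ncomp W (ed ` J)"
    by (simp add: ncomp_in_eq[OF W] ncomp_def)
  moreover have "card W \<le> ncomp W (ed ` J) + card (ed ` J)"
  proof (rule card_le_ncomp)
    show "finite (ed ` J)" using I(1) by (simp add: J_def)
    show "\<exists>u w. e = {u, w}" if "e \<in> ed ` J" for e
      using that edge_ends[of e] unfolding J_def by blast
  qed (use fin in simp)
  moreover have "card (ed ` J) \<le> card J" using I(1) by (simp add: J_def card_image_le)
  moreover have "card J \<le> card {i \<in> I. avoids (ed i) (map set (P i)) W}"
    using I(1) by (intro card_mono) (auto simp: J_def)
  ultimately show ?thesis by linarith
qed

end

section \<open>Optimal stopping\<close>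

lemma sqrt_le_linear:
  fixes c \<epsilon> :: real
  assumes "\<epsilon> > 0"
  obtains N0 :: nat where "N0 > 0" "\<And>N. N \<ge> N0 \<Longrightarrow> c * sqrt (real N) \<le> \<epsilon> * real N"
proof
  define N0 where "N0 = nat \<lceil>(c / \<epsilon>)\<^sup>2\<rceil> + 1"
  show "N0 > 0" by (simp add: N0_def)
  fix N :: nat assume "N \<ge> N0"
  then have "(c / \<epsilon>)\<^sup>2 \<le> real N"
    unfolding N0_def by linarith
  then have "c / \<epsilon> \<le> sqrt (real N)"
    by (rule real_le_rsqrt)
  then have "c / \<epsilon> * sqrt (real N) \<le> sqrt (real N) * sqrt (real N)"
    by (intro mult_right_mono) auto
  then show "c * sqrt (real N) \<le> \<epsilon> * real N"
    using assms by (simp add: field_simps)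
qed

text \<open>A path may climb on its way; only its last vertex has to be lower. \<open>K\<close>
  bounds both the number of inclusion-exclusion steps and the number of points involved, the strict
  inequality leaving room for \<open>v\<close> itself.\<close>

definition descent_paths :: "'a graph \<Rightarrow> ('a \<Rightarrow> real) \<Rightarrow> nat \<Rightarrow> ('a \<Rightarrow> 'a list list) \<Rightarrow> bool" where
  "descent_paths G r K P \<longleftrightarrow> (\<forall>v\<in>verts G. length (P v) \<le> K \<and> length (concat (P v)) < K \<and>
    (\<forall>p\<in>set (P v). set p \<subseteq> verts G \<and>
      p \<noteq> [] \<and> successively (\<lambda>x y. {x, y} \<in> edges G) (v # p) \<and> r (last p) < r v))"

text \<open>Indices replace edges because the detours belong to a cell and a direction. The map
  \<open>ed\<close> may repeat an edge, which only enlarges the count. The summand 2 leaves room for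
  the two ends.\<close>

definition shortcut_paths ::
    "'a graph \<Rightarrow> ('a set \<Rightarrow> real) \<Rightarrow> nat \<Rightarrow> 'i set \<Rightarrow> ('i \<Rightarrow> 'a set) \<Rightarrow> ('i \<Rightarrow> 'a list list) \<Rightarrow> bool" where
  "shortcut_paths G r K I ed P \<longleftrightarrow> finite I \<and> edges G \<subseteq> ed ` I \<and>
    (\<forall>i\<in>I. ed i \<subseteq> verts G \<and> card (ed i) \<le> 2 \<and>
      length (P i) \<le> K \<and> length (concat (P i)) + 2 \<le> K \<and>
      (\<forall>p\<in>set (P i). set p \<subseteq> verts G \<and> p \<noteq> [] \<and> ed i = {hd p, last p} \<and>
        successively (\<lambda>x y. {x, y} \<in> edges G \<and> r {x, y} < r (ed i)) p))"

context bounded_degree_graph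
begin

definition mean_ncomp :: "nat \<Rightarrow> real" where
  "mean_ncomp t = perm_avg (verts G) (\<lambda>\<sigma>. real (ncomp_in G (first t \<sigma>)))"

lemma expected_components_eq:
  "expected_components G \<tau> = perm_avg (verts G) (\<lambda>\<sigma>. real (ncomp_in G (first (\<tau> \<sigma>) \<sigma>)))"
  by (simp add: expected_components_def perm_avg_def num_components_def ncomp_in_def)

lemma orders_nonempty: "orders G \<noteq> {}"
  using finite_verts by (simp add: permutations_of_set_empty_iff)

lemma blind_const_stopping_time:
  assumes "t \<in> {1..card (verts G)}"
  shows "is_stopping_time G (blind G) (\<lambda>_. t)" "is_stopping_time G (full_information G) (\<lambda>_. t)"
  using assms by (auto simp: is_stopping_time_def blind_def full_information_def)

text \<open>Every fibre of a blind stopping time is empty or everything, so the time is constant on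
  \<open>orders G\<close> and optimality means maximizing \<open>mean_ncomp\<close>.\<close>

lemma blind_optimal:
  assumes "is_optimal G (blind G) \<tau>"
  shows "\<exists>t\<in>{1..card (verts G)}. expected_components G \<tau> = mean_ncomp t"
    and "\<And>t. t \<in> {1..card (verts G)} \<Longrightarrow> mean_ncomp t \<le> expected_components G \<tau>"
proof -
  obtain \<sigma> where \<sigma>: "\<sigma> \<in> orders G" using orders_nonempty by blast
  have stop: "is_stopping_time G (blind G) \<tau>" using assms by (simp add: is_optimal_def)
  then have t: "\<tau> \<sigma> \<in> {1..card (verts G)}" using \<sigma> by (auto simp: is_stopping_time_def)
  then have "{\<pi> \<in> orders G. \<tau> \<pi> = \<tau> \<sigma>} \<in> blind G (\<tau> \<sigma>)"
    using stop by (auto simp: is_stopping_time_def)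
  then have "\<tau> \<pi> = \<tau> \<sigma>" if "\<pi> \<in> orders G" for \<pi>
    using \<sigma> that by (auto simp: blind_def)
  then have "expected_components G \<tau> = mean_ncomp (\<tau> \<sigma>)"
    unfolding expected_components_eq mean_ncomp_def by (intro perm_avg_cong) simp
  then show "\<exists>t\<in>{1..card (verts G)}. expected_components G \<tau> = mean_ncomp t"
    using t by blast
  show "mean_ncomp t \<le> expected_components G \<tau>" if "t \<in> {1..card (verts G)}" for t
    using assms blind_const_stopping_time(1)[OF that]
    unfolding is_optimal_def mean_ncomp_def by (auto simp: expected_components_eq)
qed

text \<open>A constant time is also admissible in the full information game.\<close>

lemma blind_le_full_information:
  assumes "is_optimal G (blind G) \<tau>b" "is_optimal G (full_information G) \<tau>f"
  shows "expected_components G \<tau>b \<le> expected_components G \<tau>f"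
proof -
  obtain t where t: "t \<in> {1..card (verts G)}" "expected_components G \<tau>b = mean_ncomp t"
    using blind_optimal(1)[OF assms(1)] by blast
  have "expected_components G \<tau>b = expected_components G (\<lambda>_. t)"
    unfolding t(2) by (simp add: mean_ncomp_def expected_components_eq)
  also have "\<dots> \<le> expected_components G \<tau>f"
    using assms(2) blind_const_stopping_time(2)[OF t(1)] unfolding is_optimal_def by blast
  finally show ?thesis .
qed

lemma ncomp_in_deviation:
  assumes "verts G \<noteq> {}"
  shows "perm_avg (verts G) (\<lambda>\<sigma>. \<bar>real (ncomp_in G (first t \<sigma>)) - mean_ncomp t\<bar>)
    \<le> ((real D)\<^sup>2 + 1) * sqrt (card (verts G))"
  unfolding mean_ncomp_def
proof (rule perm_avg_deviation[OF finite_verts assms])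
  fix \<sigma> a b assume *: "\<sigma> \<in> orders G" "a \<in> verts G" "b \<in> verts G"
  have "first t \<sigma> \<subseteq> verts G"
    using * by (auto simp: permutations_of_setD dest: in_set_takeD)
  then show "\<bar>real (ncomp_in G (first t (map (swap a b) \<sigma>))) - real (ncomp_in G (first t \<sigma>))\<bar> \<le> real D"
    using ncomp_in_swap[of "first t \<sigma>" a b] * by (simp add: take_map)
qed

text \<open>It suffices to control the process at about \<open>1 / \<eta>\<close> times, since it increases by at most
  one per step.\<close>

lemma expected_components_le:
  fixes \<eta> :: real
  assumes \<tau>: "\<tau> \<in> orders G \<rightarrow> {1..card (verts G)}" and \<eta>: "0 < \<eta>" and ne: "verts G \<noteq> {}"
    and \<beta>: "\<And>t. t \<in> {1..card (verts G)} \<Longrightarrow> mean_ncomp t \<le> \<beta>"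
  shows "expected_components G \<tau> \<le> \<beta> + (\<eta> * card (verts G) + 1)
    + (1 / \<eta> + 1) * (((real D)\<^sup>2 + 1) * sqrt (card (verts G)))"
proof -
  define N where "N = card (verts G)"
  have N: "N > 0" using ne finite_verts by (simp add: N_def card_gt_0_iff)
  \<comment> \<open>Spacing of the control times, rounded up to a positive integer.\<close>
  define g where "g = nat \<lceil>\<eta> * N\<rceil>"
  have g: "\<eta> * N \<le> g" "g \<le> \<eta> * N + 1" "0 < g"
    using \<eta> N unfolding g_def by (auto simp: ceiling_less_iff intro!: mult_pos_pos; linarith)+
  \<comment> \<open>Control times 1, 1 + g, 1 + 2 g and so on up to \<open>N\<close>. Starting at 1
    keeps them in the range where \<open>\<beta>\<close> bounds the mean.\<close>
  define T where "T = (\<lambda>k. 1 + k * g) ` {..(N - 1) div g}"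
  have "real (card T) \<le> real ((N - 1) div g + 1)"
    unfolding T_def by (rule of_nat_mono, rule order.trans[OF card_image_le]) auto
  also have "\<dots> \<le> real (N - 1) / g + 1"
    using of_nat_div_le_of_nat[where ?'a = real, of "N - 1" g] by simp
  also have "real (N - 1) / g \<le> N / (\<eta> * N)"
    using g N \<eta> by (intro frac_le) auto
  also have "\<dots> = 1 / \<eta>" using N by simp
  finally have T: "real (card T) \<le> 1 / \<eta> + 1" by simp
  have "real (ncomp_in G (first (\<tau> \<sigma>) \<sigma>))
      \<le> (\<beta> + g) + (\<Sum>s\<in>T. \<bar>real (ncomp_in G (first s \<sigma>)) - mean_ncomp s\<bar>)"
    if \<sigma>: "\<sigma> \<in> orders G" for \<sigma>
  proof -
    define t where "t = \<tau> \<sigma>"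
    define s where "s = 1 + (t - 1) div g * g"
    have t: "1 \<le> t" "t \<le> N" using \<tau> \<sigma> by (auto simp: t_def N_def)
    have "(t - 1) div g * g + (t - 1) mod g = t - 1" by simp
    moreover have "(t - 1) mod g < g" using g by simp
    ultimately have s: "s \<le> t" "t - s \<le> g" "1 \<le> s"
      using t unfolding s_def by linarith+
    have "s \<in> T"
      unfolding s_def T_def using t by (auto intro!: imageI div_le_mono)
    have split: "first t \<sigma> = first s \<sigma> \<union> first (t - s) (drop s \<sigma>)"
      using s(1) by (metis le_add_diff_inverse set_append take_add)
    have "set \<sigma> = verts G" using \<sigma> by (simp add: permutations_of_setD)
    then have "first s \<sigma> \<union> first (t - s) (drop s \<sigma>) \<subseteq> verts G"
      by (auto dest: in_set_takeD in_set_dropD)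
    then have "ncomp_in G (first t \<sigma>) \<le> ncomp_in G (first s \<sigma>) + card (first (t - s) (drop s \<sigma>))"
      unfolding split by (rule ncomp_in_union)
    moreover have "card (first (t - s) (drop s \<sigma>)) \<le> g"
      using s(2) by (intro order.trans[OF card_length]) simp
    moreover have "mean_ncomp s \<le> \<beta>"
      using s t by (intro \<beta>) (auto simp: N_def)
    \<comment> \<open>The control time \<open>s\<close> depends on the permutation, hence the
      passage to the sum over all of \<open>T\<close>.\<close>
    moreover have "\<bar>real (ncomp_in G (first s \<sigma>)) - mean_ncomp s\<bar>
        \<le> (\<Sum>s\<in>T. \<bar>real (ncomp_in G (first s \<sigma>)) - mean_ncomp s\<bar>)"
      using \<open>s \<in> T\<close> by (intro member_le_sum) (auto simp: T_def)
    ultimately show ?thesis unfolding t_def[symmetric] by linarith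
  qed
  then have "expected_components G \<tau> \<le> perm_avg (verts G)
      (\<lambda>\<sigma>. (\<beta> + g) + (\<Sum>s\<in>T. \<bar>real (ncomp_in G (first s \<sigma>)) - mean_ncomp s\<bar>))"
    unfolding expected_components_eq by (rule perm_avg_mono)
  also have "\<dots> = (\<beta> + g) + (\<Sum>s\<in>T. perm_avg (verts G)
      (\<lambda>\<sigma>. \<bar>real (ncomp_in G (first s \<sigma>)) - mean_ncomp s\<bar>))"
    by (simp add: perm_avg_add perm_avg_sum finite_verts)
  also have "\<dots> \<le> (\<beta> + g) + (\<Sum>s\<in>T. ((real D)\<^sup>2 + 1) * sqrt N)"
    unfolding N_def by (intro add_left_mono sum_mono ncomp_in_deviation ne)
  also have "\<dots> \<le> (\<beta> + (\<eta> * N + 1)) + (1 / \<eta> + 1) * (((real D)\<^sup>2 + 1) * sqrt N)"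
    unfolding sum_constant using g(2) T by (intro add_mono mult_right_mono) auto
  finally show ?thesis by (simp add: N_def)
qed

text \<open>Each of the \<open>N\<close> vertices contributes an error of order
  \<open>1 / N\<close>, so the total error is a constant.\<close>

lemma mean_ncomp_upper:
  fixes r :: "'a \<Rightarrow> real"
  assumes t: "t \<le> card (verts G)" and K: "0 < K" "2 * K \<le> card (verts G)"
    and paths: "descent_paths G r K P"
  shows "mean_ncomp t \<le> (\<Sum>v\<in>verts G. avoid_poly {v} (map set (P v)) (t / card (verts G)))
    + 2 ^ K * (2 * (real K)\<^sup>2)"
proof -
  let ?N = "card (verts G)"
  have P: "set p \<subseteq> verts G \<and>
      p \<noteq> [] \<and> successively (\<lambda>x y. {x, y} \<in> edges G) (v # p) \<and> r (last p) < r v"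
    if "v \<in> verts G" "p \<in> set (P v)" for v p
    using paths that unfolding descent_paths_def by blast
  have size: "length (P v) \<le> K" "length (concat (P v)) < K" if "v \<in> verts G" for v
    using paths that unfolding descent_paths_def by blast+
  have "mean_ncomp t \<le> perm_avg (verts G)
      (\<lambda>\<sigma>. \<Sum>v\<in>verts G. of_bool (avoids {v} (map set (P v)) (first t \<sigma>)))"
    unfolding mean_ncomp_def
  proof (rule perm_avg_mono)
    fix \<sigma> assume "\<sigma> \<in> orders G"
    then have "ncomp_in G (first t \<sigma>) \<le> card {v \<in> verts G. avoids {v} (map set (P v)) (first t \<sigma>)}"
      using P by (intro ncomp_in_upper[where r = r] card_first(2) t) blast+
    then show "real (ncomp_in G (first t \<sigma>)) \<le>
        (\<Sum>v\<in>verts G. of_bool (avoids {v} (map set (P v)) (first t \<sigma>)))"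
      using finite_verts by (simp only: sum_of_bool_eq) (simp add: Collect_conj_eq Int_commute)
  qed
  also have "\<dots> \<le> (\<Sum>v\<in>verts G. avoid_poly {v} (map set (P v)) (t / ?N) + 2 ^ K * (2 * (real K)\<^sup>2 / ?N))"
    unfolding perm_avg_sum
  proof (rule sum_mono)
    fix v assume v: "v \<in> verts G"
    have un: "{v} \<union> \<Union>(set (map set (P v))) = set (v # concat (P v))" by auto
    have "card ({v} \<union> \<Union>(set (map set (P v)))) \<le> K"
      unfolding un using size[OF v] by (intro order.trans[OF card_length]) simp
    moreover have "{v} \<union> \<Union>(set (map set (P v))) \<subseteq> verts G"
    proof -
      have "set p \<subseteq> verts G" if "p \<in> set (P v)" for p
        using P[OF v that] by blast
      then show ?thesis using v by auto
    qed
    ultimately have "\<bar>perm_avg (verts G) (\<lambda>\<sigma>. of_bool (avoids {v} (map set (P v)) (first t \<sigma>)))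
        - avoid_poly {v} (map set (P v)) (t / ?N)\<bar> \<le> 2 ^ length (map set (P v)) * (2 * (real K)\<^sup>2 / ?N)"
      by (intro avoid_poly_approx finite_verts t K)
    also have "\<dots> \<le> 2 ^ K * (2 * (real K)\<^sup>2 / ?N)"
      using size[OF v] by (intro mult_right_mono power_increasing) auto
    finally show "perm_avg (verts G) (\<lambda>\<sigma>. of_bool (avoids {v} (map set (P v)) (first t \<sigma>)))
        \<le> avoid_poly {v} (map set (P v)) (t / ?N) + 2 ^ K * (2 * (real K)\<^sup>2 / ?N)"
      by linarith
  qed
  also have "\<dots> = (\<Sum>v\<in>verts G. avoid_poly {v} (map set (P v)) (t / ?N)) + 2 ^ K * (2 * (real K)\<^sup>2)"
    using K by (simp add: sum.distrib)
  finally show ?thesis .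
qed

text \<open>This is the mean of vertices <= components + surviving edges, where the number of
  present vertices is exactly \<open>t\<close>.\<close>

lemma mean_ncomp_lower:
  fixes r :: "'a set \<Rightarrow> real" and I :: "'i set"
  assumes t: "t \<le> card (verts G)" and K: "0 < K" "2 * K \<le> card (verts G)"
    and paths: "shortcut_paths G r K I ed P"
  shows "real t \<le> mean_ncomp t + (\<Sum>i\<in>I. avoid_poly (ed i) (map set (P i)) (t / card (verts G)))
    + card I * (2 ^ K * (2 * (real K)\<^sup>2 / card (verts G)))"
proof -
  let ?N = "card (verts G)"
  have I: "finite I" "edges G \<subseteq> ed ` I"
    using paths unfolding shortcut_paths_def by blast+
  have P: "set p \<subseteq> verts G \<and> p \<noteq> [] \<and> ed i = {hd p, last p} \<and>
      successively (\<lambda>x y. {x, y} \<in> edges G \<and> r {x, y} < r (ed i)) p"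
    if "i \<in> I" "p \<in> set (P i)" for i p
    using paths that unfolding shortcut_paths_def by blast
  have ed: "ed i \<subseteq> verts G" "card (ed i) \<le> 2"
    and size: "length (P i) \<le> K" "length (concat (P i)) + 2 \<le> K" if "i \<in> I" for i
    using paths that unfolding shortcut_paths_def by blast+
  have "real t = perm_avg (verts G) (\<lambda>_. real t)"
    using finite_verts by simp
  also have "\<dots> \<le> perm_avg (verts G)
      (\<lambda>\<sigma>. real (ncomp_in G (first t \<sigma>)) + (\<Sum>i\<in>I. of_bool (avoids (ed i) (map set (P i)) (first t \<sigma>))))"
  proof (rule perm_avg_mono)
    fix \<sigma> assume \<sigma>: "\<sigma> \<in> orders G"
    have "card (first t \<sigma>) \<le> ncomp_in G (first t \<sigma>)
        + card {i \<in> I. avoids (ed i) (map set (P i)) (first t \<sigma>)}"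
      using P by (intro ncomp_in_lower[where r = r] card_first(2)[OF \<sigma> t] I) blast+
    then show "real t \<le> real (ncomp_in G (first t \<sigma>))
        + (\<Sum>i\<in>I. of_bool (avoids (ed i) (map set (P i)) (first t \<sigma>)))"
      using I(1) card_first(1)[OF \<sigma> t]
      by (simp only: sum_of_bool_eq) (simp add: Collect_conj_eq Int_commute)
  qed
  also have "\<dots> = mean_ncomp t
      + (\<Sum>i\<in>I. perm_avg (verts G) (\<lambda>\<sigma>. of_bool (avoids (ed i) (map set (P i)) (first t \<sigma>))))"
    unfolding perm_avg_add perm_avg_sum mean_ncomp_def ..
  also have "\<dots> \<le> mean_ncomp t
      + (\<Sum>i\<in>I. avoid_poly (ed i) (map set (P i)) (t / ?N) + 2 ^ K * (2 * (real K)\<^sup>2 / ?N))"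
  proof (intro add_left_mono sum_mono)
    fix i assume i: "i \<in> I"
    have un: "ed i \<union> \<Union>(set (map set (P i))) = ed i \<union> set (concat (P i))" by auto
    have "card (ed i \<union> \<Union>(set (map set (P i)))) \<le> K"
      unfolding un using size[OF i] ed[OF i] card_length[of "concat (P i)"]
      by (intro order.trans[OF card_Un_le]) linarith
    moreover have "ed i \<union> \<Union>(set (map set (P i))) \<subseteq> verts G"
    proof -
      have "set p \<subseteq> verts G" if "p \<in> set (P i)" for p
        using P[OF i that] by blast
      then show ?thesis using ed[OF i] by auto
    qed
    ultimately have "\<bar>perm_avg (verts G) (\<lambda>\<sigma>. of_bool (avoids (ed i) (map set (P i)) (first t \<sigma>)))
        - avoid_poly (ed i) (map set (P i)) (t / ?N)\<bar> \<le> 2 ^ length (map set (P i)) * (2 * (real K)\<^sup>2 / ?N)"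
      by (intro avoid_poly_approx finite_verts t K)
    also have "\<dots> \<le> 2 ^ K * (2 * (real K)\<^sup>2 / ?N)"
      using size[OF i] by (intro mult_right_mono power_increasing) auto
    finally show "perm_avg (verts G) (\<lambda>\<sigma>. of_bool (avoids (ed i) (map set (P i)) (first t \<sigma>)))
        \<le> avoid_poly (ed i) (map set (P i)) (t / ?N) + 2 ^ K * (2 * (real K)\<^sup>2 / ?N)"
      by linarith
  qed
  finally show ?thesis by (simp add: sum.distrib)
qed

end

lemma full_information_close_to_blind:
  assumes G: "\<And>G. G \<in> \<G> \<Longrightarrow> bounded_degree_graph G D" and \<epsilon>: "0 < (\<epsilon>::real)"
  shows "\<exists>N\<^sub>0. \<forall>G \<tau>b \<tau>f. G \<in> \<G> \<and> card (verts G) \<ge> N\<^sub>0 \<and>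
      is_optimal G (blind G) \<tau>b \<and> is_optimal G (full_information G) \<tau>f \<longrightarrow>
      normalized_value G \<tau>b \<le> normalized_value G \<tau>f \<and>
      normalized_value G \<tau>f \<le> normalized_value G \<tau>b + \<epsilon>"
proof -
  \<comment> \<open>One half of \<open>\<epsilon>\<close> pays for the spacing of the control times,
    the other for the fluctuations and for the rounding term 1, which is at most
    \<open>sqrt N\<close>.\<close>
  define \<eta> where "\<eta> = \<epsilon> / 2"
  have \<eta>: "\<eta> > 0" using \<epsilon> by (simp add: \<eta>_def)
  define c where "c = (1 / \<eta> + 1) * ((real D)\<^sup>2 + 1)"
  obtain N0 where N0: "N0 > 0" "\<And>N. N \<ge> N0 \<Longrightarrow> (c + 1) * sqrt (real N) \<le> \<eta> * real N"
    using sqrt_le_linear[OF \<eta>] by blast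
  show ?thesis
  proof (intro exI[of _ N0] allI impI)
    fix G \<tau>b \<tau>f
    assume *: "G \<in> \<G> \<and> card (verts G) \<ge> N0 \<and> is_optimal G (blind G) \<tau>b \<and> is_optimal G (full_information G) \<tau>f"
    interpret bounded_degree_graph G D using G * by blast
    define N where "N = card (verts G)"
    have N: "N > 0" "(c + 1) * sqrt N \<le> \<eta> * N" using * N0 by (auto simp: N_def)
    have ne: "verts G \<noteq> {}" using N by (auto simp: N_def)
    have "\<tau>f \<in> orders G \<rightarrow> {1..N}"
      using * unfolding is_optimal_def is_stopping_time_def N_def by blast
    then have "expected_components G \<tau>f \<le> expected_components G \<tau>b + (\<eta> * N + 1)
        + (1 / \<eta> + 1) * (((real D)\<^sup>2 + 1) * sqrt N)"
      unfolding N_def using * by (intro expected_components_le \<eta> ne blind_optimal(2)) auto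
    moreover have "(1 / \<eta> + 1) * (((real D)\<^sup>2 + 1) * sqrt N) = c * sqrt N"
      by (simp add: c_def)
    moreover have "1 \<le> sqrt N" using N by simp
    moreover have "(c + 1) * sqrt N = c * sqrt N + sqrt N" "\<eta> * N + \<eta> * N = \<epsilon> * N"
      by (simp_all add: \<eta>_def algebra_simps)
    ultimately have "expected_components G \<tau>f \<le> expected_components G \<tau>b + \<epsilon> * N"
      using N(2) by linarith
    then show "normalized_value G \<tau>b \<le> normalized_value G \<tau>f \<and>
        normalized_value G \<tau>f \<le> normalized_value G \<tau>b + \<epsilon>"
      using blind_le_full_information[of \<tau>b \<tau>f] * N(1)
      by (simp add: normalized_value_def field_simps flip: N_def)
  qed
qed

text \<open>The optimal time is unknown, so the polynomial estimate is required at every density.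
  The gap between \<open>M\<close> and \<open>M'\<close> absorbs the errors of order sqrt N.\<close>

lemma blind_value_upper:
  fixes M M' c :: real
  assumes G: "\<And>G. G \<in> \<G> \<Longrightarrow> bounded_degree_graph G D" and "M < M'" "0 < K"
    and P: "\<And>G. G \<in> \<G> \<Longrightarrow> \<exists>r P. descent_paths G r K P \<and>
      (\<forall>p\<in>{0..1}. (\<Sum>v\<in>verts G. avoid_poly {v} (map set (P v)) p)
        \<le> M * card (verts G) + c * sqrt (card (verts G)))"
  shows "\<exists>N\<^sub>0. \<forall>G \<tau>. G \<in> \<G> \<and> card (verts G) \<ge> N\<^sub>0 \<and> is_optimal G (blind G) \<tau> \<longrightarrow>
    normalized_value G \<tau> \<le> M'"
proof -
  have pos: "M' - M > 0" using assms by simp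
  define C where "C = 2 ^ K * (2 * (real K)\<^sup>2)"
  obtain N0 where N0: "N0 > 0" "\<And>N. N \<ge> N0 \<Longrightarrow> (c + C) * sqrt (real N) \<le> (M' - M) * real N"
    using sqrt_le_linear[OF pos] by blast
  show ?thesis
  proof (intro exI[of _ "N0 + 2 * K"] allI impI)
    fix G \<tau>
    assume *: "G \<in> \<G> \<and> card (verts G) \<ge> N0 + 2 * K \<and> is_optimal G (blind G) \<tau>"
    interpret bounded_degree_graph G D using G * by blast
    define N where "N = card (verts G)"
    have N: "N > 0" "2 * K \<le> N" "(c + C) * sqrt N \<le> (M' - M) * N" using * N0 by (auto simp: N_def)
    obtain t where t: "t \<in> {1..N}" "expected_components G \<tau> = mean_ncomp t"
      using blind_optimal(1) * unfolding N_def by blast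
    obtain r P where paths: "descent_paths G r K P"
      and bd: "\<forall>p\<in>{0..1}. (\<Sum>v\<in>verts G. avoid_poly {v} (map set (P v)) p) \<le> M * N + c * sqrt N"
      using P[OF conjunct1[OF *]] unfolding N_def by blast
    have "mean_ncomp t \<le> (\<Sum>v\<in>verts G. avoid_poly {v} (map set (P v)) (t / N)) + C"
      unfolding C_def N_def
      by (rule mean_ncomp_upper[OF _ _ _ paths]) (use t N \<open>0 < K\<close> in \<open>auto simp: N_def\<close>)
    also have "\<dots> \<le> M * N + c * sqrt N + C * sqrt N"
    proof (rule add_mono)
      have "C * 1 \<le> C * sqrt N"
        using N(1) by (intro mult_left_mono) (auto simp: C_def)
      then show "C \<le> C * sqrt N" by simp
    qed (use t in \<open>intro bd[rule_format], auto\<close>)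
    also have "\<dots> \<le> M' * N" using N(3) by (simp add: algebra_simps)
    finally show "normalized_value G \<tau> \<le> M'"
      unfolding normalized_value_def t(2) using N(1) by (simp add: field_simps flip: N_def)
  qed
qed

lemma blind_value_lower:
  fixes L c p0 :: real and H :: "real \<Rightarrow> real"
  assumes G: "\<And>G. G \<in> \<G> \<Longrightarrow> bounded_degree_graph G D" and "0 < K" "0 \<le> c"
    and p0: "0 < p0" "p0 < 1" and H: "isCont H p0" "L < p0 - H p0"
    and P: "\<And>G. G \<in> \<G> \<Longrightarrow> \<exists>r (I :: 'i set) ed P.
      shortcut_paths G r K I ed P \<and> card I \<le> c * card (verts G) \<and>
      (\<forall>p\<in>{0..1}. (\<Sum>i\<in>I. avoid_poly (ed i) (map set (P i)) p)
        \<le> H p * card (verts G) + c * sqrt (card (verts G)))"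
  shows "\<exists>N\<^sub>0. \<forall>G \<tau>. G \<in> \<G> \<and> card (verts G) \<ge> N\<^sub>0 \<and> is_optimal G (blind G) \<tau> \<longrightarrow>
    L \<le> normalized_value G \<tau>"
proof -
  \<comment> \<open>Half of the slack is spent on replacing \<open>p0\<close> by a nearby
    \<open>t / N\<close>, the other half on the errors of order sqrt N.\<close>
  define \<delta> where "\<delta> = (p0 - H p0 - L) / 2"
  have \<delta>: "\<delta> > 0" "L + \<delta> < p0 - H p0" using H(2) by (auto simp: \<delta>_def field_simps)
  have "isCont (\<lambda>p. p - H p) p0" using H(1) by (intro continuous_intros)
  then obtain \<eta> where \<eta>0: "\<eta> > 0"
      "\<forall>p. dist p p0 < \<eta> \<longrightarrow> dist (p - H p) (p0 - H p0) < p0 - H p0 - (L + \<delta>)"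
    using \<delta>(2) unfolding continuous_at_eps_delta by (meson diff_gt_0_iff_gt)
  have \<eta>: "L + \<delta> < p - H p" if "\<bar>p - p0\<bar> < \<eta>" for p
    using \<eta>0(2)[rule_format, of p] that by (simp add: dist_real_def abs_if split: if_splits)
  define C where "C = c * (2 ^ K * (2 * (real K)\<^sup>2))"
  have C: "0 \<le> C" using \<open>0 \<le> c\<close> by (simp add: C_def)
  obtain N0 where N0: "N0 > 0" "\<And>N. N \<ge> N0 \<Longrightarrow> (c + C) * sqrt (real N) \<le> \<delta> * real N"
    using sqrt_le_linear[OF \<delta>(1)] by blast
  obtain N1 :: nat where N1: "N1 > 1 / \<eta>" using reals_Archimedean2 by blast
  show ?thesis
  proof (intro exI[of _ "N0 + N1 + 2 * K"] allI impI)
    fix G \<tau>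
    assume *: "G \<in> \<G> \<and> card (verts G) \<ge> N0 + N1 + 2 * K \<and> is_optimal G (blind G) \<tau>"
    interpret bounded_degree_graph G D using G * by blast
    define N where "N = card (verts G)"
    have N: "N > 0" "2 * K \<le> N" "(c + C) * sqrt N \<le> \<delta> * N" "1 / \<eta> < N"
      using * N0 N1 by (auto simp: N_def)
    \<comment> \<open>The density has to be realized by an integer time; rounding moves it by at
      most \<open>1 / N\<close>, which the continuity of \<open>H\<close> at \<open>p0\<close>
      tolerates.\<close>
    define t where "t = nat \<lceil>p0 * N\<rceil>"
    have t: "p0 * N \<le> t" "t < p0 * N + 1"
      using p0 N unfolding t_def by (auto intro!: mult_nonneg_nonneg; linarith)+
    have "0 < p0 * N" "p0 * N \<le> N" using p0 N by auto
    then have t1: "1 \<le> t" "t \<le> N" using t by linarith+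
    have "t / N - p0 = (t - p0 * N) / N" using N by (simp add: field_simps)
    also have "\<bar>\<dots>\<bar> \<le> 1 / N"
      using t N unfolding abs_divide by (intro frac_le) auto
    also have "1 / N < \<eta>" using N(1,4) \<eta>0(1) by (simp add: field_simps)
    finally have close: "L + \<delta> < t / N - H (t / N)" by (rule \<eta>)
    obtain r and I :: "'i set" and ed P where paths: "shortcut_paths G r K I ed P"
      and I: "card I \<le> c * N"
      and bd: "\<forall>p\<in>{0..1}. (\<Sum>i\<in>I. avoid_poly (ed i) (map set (P i)) p) \<le> H p * N + c * sqrt N"
      using P[OF conjunct1[OF *]] unfolding N_def by blast
    have "real t \<le> mean_ncomp t + (\<Sum>i\<in>I. avoid_poly (ed i) (map set (P i)) (t / N))
        + card I * (2 ^ K * (2 * (real K)\<^sup>2 / N))"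
      unfolding N_def
      by (rule mean_ncomp_lower[OF _ _ _ paths]) (use t1 N \<open>0 < K\<close> in \<open>auto simp: N_def\<close>)
    moreover have "(\<Sum>i\<in>I. avoid_poly (ed i) (map set (P i)) (t / N)) \<le> H (t / N) * N + c * sqrt N"
      using t1 N by (intro bd[rule_format]) auto
    moreover have "card I * (2 ^ K * (2 * (real K)\<^sup>2 / N)) \<le> C"
    proof -
      have "card I * (2 ^ K * (2 * (real K)\<^sup>2 / N)) \<le> (c * N) * (2 ^ K * (2 * (real K)\<^sup>2 / N))"
        using I by (intro mult_right_mono) auto
      then show ?thesis using N(1) by (simp add: C_def)
    qed
    moreover have "C \<le> C * sqrt N" using N(1) C by (simp add: mult_le_cancel_left1)
    moreover have "(L + \<delta>) * N \<le> t - H (t / N) * N"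
    proof -
      have "(L + \<delta>) * N \<le> (t / N - H (t / N)) * N"
        using close by (intro mult_right_mono) auto
      then show ?thesis using N(1) by (simp add: left_diff_distrib)
    qed
    ultimately have "L * N \<le> mean_ncomp t"
      using N(3) by (simp add: algebra_simps)
    also have "\<dots> \<le> expected_components G \<tau>"
      using t1 * by (intro blind_optimal(2)) (auto simp: N_def)
    finally show "L \<le> normalized_value G \<tau>"
      unfolding normalized_value_def using N(1) by (simp add: field_simps flip: N_def)
  qed
qed

section \<open>Locally periodic graphs\<close>

text \<open>Only cardinalities of unions enter, so the polynomial at every cell is that of the fixed
  offsets.\<close>

lemma avoid_poly_image:
  assumes "inj f"
  shows "avoid_poly (f ` A) (map ((`) f) Qs) p = avoid_poly A Qs p"
proof (induction Qs arbitrary: A)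
  case Nil
  then show ?case using assms by (simp add: card_image inj_on_subset)
next
  case (Cons Q Qs)
  then show ?case by (simp add: image_Un[symmetric])
qed

text \<open>The weights only serve to make the comparisons along the explicit paths below strict.\<close>

definition level :: "int \<times> int \<Rightarrow> real" where
  "level v = real_of_int (10 * fst v + snd v)"

lemma level_add: "level (u + v) = level u + level v"
  by (simp add: level_def)

text \<open>A finite piece of a lattice in which each \<open>b \<in> B\<close> carries a complete neighbourhood: the
  vertices belonging to the cell of \<open>b\<close> are \<open>e (b + x)\<close> for \<open>x \<in> os\<close>, the edges are
  \<open>{e (b + x), e (b + y)}\<close> for \<open>(x, y) \<in> ds\<close>, and \<open>adj\<close> describes the edges around \<open>b\<close>.\<close>

locale periodic_graph = bounded_degree_graph G D for G :: "'a graph" and D +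
  fixes e :: "int \<times> int \<Rightarrow> 'a"
    and adj :: "int \<times> int \<Rightarrow> int \<times> int \<Rightarrow> bool"
    and os :: "(int \<times> int) list" and ds :: "((int \<times> int) \<times> (int \<times> int)) list"
    and B U :: "(int \<times> int) set" and c :: real
  assumes inj_e: "inj e"
    and finite_U: "finite U" and B_subset: "B \<subseteq> U"
    and adj_edge: "b \<in> B \<Longrightarrow> adj x y \<Longrightarrow> {e (b + x), e (b + y)} \<in> edges G"
    and cell_verts: "b \<in> B \<Longrightarrow> x \<in> set os \<Longrightarrow> e (b + x) \<in> verts G"
    and cell_inj: "inj_on (\<lambda>(b, x). b + x) (B \<times> set os)"
    and distinct_os: "distinct os" and distinct_ds: "distinct ds"
    and cell_edges: "(x, y) \<in> set ds \<Longrightarrow> adj x y \<and> x \<noteq> y"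
    and os_nonempty: "os \<noteq> []"
    and edges_subset: "edges G \<subseteq> (\<lambda>(b, (x, y)). {e (b + x), e (b + y)}) ` (U \<times> set ds)"
    and bulk_U: "card U \<le> card B + c * sqrt (card (verts G))"
    and bulk_verts: "card (verts G) \<le> length os * card B + c * sqrt (card (verts G))"
    and c_nonneg: "0 \<le> c"
begin

definition vertex_level :: "'a \<Rightarrow> real" where
  "vertex_level v = level (inv e v)"

definition edge_level :: "'a set \<Rightarrow> real" where
  "edge_level E = (\<Sum>v\<in>E. vertex_level v)"

lemma vertex_level_e [simp]: "vertex_level (e x) = level x"
  by (simp add: vertex_level_def inj_e)

lemma edge_level_e: "x \<noteq> y \<Longrightarrow> edge_level {e x, e y} = level x + level y"
  using inj_e by (simp add: edge_level_def inj_eq)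

lemma inj_shift: "inj (\<lambda>q. e (b + q))"
  by (rule injI, rule add_left_imp_eq[OF injD[OF inj_e]])

lemma finite_B: "finite B"
  using finite_U B_subset finite_subset by blast

lemma inj_on_cells: "inj_on (\<lambda>(b, x). e (b + x)) (B \<times> set os)"
  using comp_inj_on[OF cell_inj inj_on_subset[OF inj_e subset_UNIV]]
  by (simp add: o_def case_prod_unfold)

lemma card_cells: "length os * card B \<le> card (verts G)"
proof -
  have "card ((\<lambda>(b, x). e (b + x)) ` (B \<times> set os)) = card (B \<times> set os)"
    by (rule card_image[OF inj_on_cells])
  also have "\<dots> = length os * card B"
    by (simp add: card_cartesian_product distinct_card[OF distinct_os] mult.commute)
  finally have "length os * card B = card ((\<lambda>(b, x). e (b + x)) ` (B \<times> set os))" ..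
  also have "\<dots> \<le> card (verts G)"
    using cell_verts by (intro card_mono finite_verts) auto
  finally show ?thesis .
qed

lemma successively_adj:
  assumes "b \<in> B" "successively adj p"
  shows "successively (\<lambda>x y. {x, y} \<in> edges G) (map (\<lambda>q. e (b + q)) p)"
  unfolding successively_map
  by (rule successively_mono[OF assms(2)]) (rule adj_edge[OF assms(1)])

lemma successively_adj_verts:
  assumes "b \<in> B" "successively adj p" "x \<in> set p" "length p \<ge> 2"
  shows "e (b + x) \<in> verts G"
proof -
  obtain i where i: "i < length p" "x = p ! i" using assms(3) by (metis in_set_conv_nth)
  have E: "{e (b + p ! j), e (b + p ! Suc j)} \<in> edges G" if "Suc j < length p" for j
    using assms(1,2) adj_edge that by (auto simp: successively_conv_nth)
  have sub: "{u, w} \<in> edges G \<Longrightarrow> u \<in> verts G \<and> w \<in> verts G" for u w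
    using edge_ends by (metis doubleton_eq_iff)
  show ?thesis
  proof (cases i)
    case 0
    then show ?thesis using E[of 0] sub i assms(4) by auto
  next
    case (Suc j)
    then show ?thesis using E[of j] sub i by auto
  qed
qed

text \<open>The offset paths are copied into every cell. By \<open>bulk_verts\<close> only order
  sqrt N vertices lie outside the cells; they get no paths and count at most one each.\<close>

lemma descent_paths_exist:
  fixes Ps :: "int \<times> int \<Rightarrow> (int \<times> int) list list" and M :: real
  assumes Ps: "\<And>x p. x \<in> set os \<Longrightarrow> p \<in> set (Ps x) \<Longrightarrow>
      p \<noteq> [] \<and> successively adj (x # p) \<and> level (last p) < level x"
    and size: "\<And>x. x \<in> set os \<Longrightarrow> length (Ps x) \<le> K \<and> length (concat (Ps x)) < K"
    and "0 < K"
    and M: "0 \<le> M" "\<And>p. p \<in> {0..1} \<Longrightarrow> (\<Sum>x\<leftarrow>os. avoid_poly {x} (map set (Ps x)) p) \<le> length os * M"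
  shows "\<exists>r P. descent_paths G r K P \<and>
    (\<forall>p\<in>{0..1}. (\<Sum>v\<in>verts G. avoid_poly {v} (map set (P v)) p)
      \<le> M * card (verts G) + c * sqrt (card (verts G)))"
proof -
  define f where "f = (\<lambda>(b, x). e (b + x))"
  define C where "C = f ` (B \<times> set os)"
  have inj_f: "inj_on f (B \<times> set os)"
    unfolding f_def by (rule inj_on_cells)
  \<comment> \<open>A vertex is decoded into base point and offset by inverting the injective map
    \<open>f\<close>.\<close>
  define P where "P v = (if v \<in> C then case inv_into (B \<times> set os) f v of
    (b, x) \<Rightarrow> map (map (\<lambda>q. e (b + q))) (Ps x) else [])" for v
  have P: "P (e (b + x)) = map (map (\<lambda>q. e (b + q))) (Ps x)" if "b \<in> B" "x \<in> set os" for b x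
  proof -
    have "inv_into (B \<times> set os) f (f (b, x)) = (b, x)"
      using that by (intro inv_into_f_f inj_f) auto
    moreover have "f (b, x) \<in> C" using that by (auto simp: C_def)
    ultimately show ?thesis by (simp add: P_def f_def)
  qed
  have out: "P v = []" if "v \<notin> C" for v using that by (simp add: P_def)
  have CE: "\<exists>b\<in>B. \<exists>x\<in>set os. v = e (b + x)" if "v \<in> C" for v
    using that by (auto simp: C_def f_def)
  have "descent_paths G vertex_level K P"
    unfolding descent_paths_def
  proof (intro ballI conjI)
    fix v assume "v \<in> verts G"
    show "length (P v) \<le> K"
      by (cases "v \<in> C") (use CE P size out in fastforce)+
    show "length (concat (P v)) < K"
    proof (cases "v \<in> C")
      case True
      then obtain b x where "b \<in> B" "x \<in> set os" "v = e (b + x)" using CE by blast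
      then show ?thesis using size P by (simp add: map_concat[symmetric])
    qed (use out \<open>0 < K\<close> in simp)
    fix p assume p: "p \<in> set (P v)"
    then have "v \<in> C" using out by fastforce
    then obtain b x where bx: "b \<in> B" "x \<in> set os" "v = e (b + x)" using CE by blast
    then obtain q where q: "q \<in> set (Ps x)" "p = map (\<lambda>q. e (b + q)) q"
      using p P by auto
    note * = Ps[OF bx(2) q(1)]
    show "set p \<subseteq> verts G"
      unfolding q(2) using * bx(1) by (auto intro!: successively_adj_verts[of b "x # q"] simp: Suc_le_eq)
    show "p \<noteq> []" using * q by simp
    show "successively (\<lambda>x y. {x, y} \<in> edges G) (v # p)"
      using successively_adj[OF bx(1), of "x # q"] * by (simp add: q(2) bx(3))
    show "vertex_level (last p) < vertex_level v"
      using * by (simp add: q(2) bx(3) last_map level_add)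
  qed
  moreover have "(\<Sum>v\<in>verts G. avoid_poly {v} (map set (P v)) p)
      \<le> M * card (verts G) + c * sqrt (card (verts G))" if p: "p \<in> {0..1}" for p
  proof -
    have "C \<subseteq> verts G" using cell_verts by (auto simp: C_def f_def)
    then have "(\<Sum>v\<in>verts G. avoid_poly {v} (map set (P v)) p)
        = (\<Sum>v\<in>verts G - C. avoid_poly {v} (map set (P v)) p) + (\<Sum>v\<in>C. avoid_poly {v} (map set (P v)) p)"
      using finite_verts by (rule sum.subset_diff)
    also have "(\<Sum>v\<in>C. avoid_poly {v} (map set (P v)) p)
        = (\<Sum>(b, x)\<in>B \<times> set os. avoid_poly {x} (map set (Ps x)) p)"
    proof -
      have "avoid_poly {e (b + x)} (map set (P (e (b + x)))) p = avoid_poly {x} (map set (Ps x)) p"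
        if "b \<in> B" "x \<in> set os" for b x
        using avoid_poly_image[OF inj_shift[of b], of "{x}" "map set (Ps x)" p] P[OF that]
        by (simp add: o_def)
      then show ?thesis
        unfolding C_def sum.reindex[OF inj_f] by (intro sum.cong) (auto simp: f_def)
    qed
    also have "\<dots> = card B * (\<Sum>x\<leftarrow>os. avoid_poly {x} (map set (Ps x)) p)"
      by (simp add: sum.cartesian_product[symmetric] sum_list_distinct_conv_sum_set distinct_os)
    also have "\<dots> \<le> card B * (length os * M)"
      by (intro mult_left_mono M(2) p) simp
    also have "\<dots> \<le> M * card (verts G)"
      using mult_left_mono[OF of_nat_mono[OF card_cells] M(1)] by (simp add: mult_ac)
    also have "(\<Sum>v\<in>verts G - C. avoid_poly {v} (map set (P v)) p) \<le> (\<Sum>v\<in>verts G - C. 1)"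
      using p out by (intro sum_mono) auto
    also have "\<dots> = real (card (verts G)) - length os * card B"
    proof -
      have "card C = length os * card B"
        unfolding C_def card_image[OF inj_f]
        by (simp add: card_cartesian_product distinct_card[OF distinct_os] mult.commute)
      then show ?thesis
        using card_Diff_subset[of C "verts G"] \<open>C \<subseteq> verts G\<close> finite_verts card_cells
        by (simp add: finite_subset of_nat_diff)
    qed
    also have "\<dots> \<le> c * sqrt (card (verts G))" using bulk_verts by simp
    finally show ?thesis by simp
  qed
  ultimately show ?thesis by blast
qed

text \<open>An index is a base point with an edge offset; only base points in \<open>B\<close>
  receive detours, and the remaining indices count at most one each. \<open>H\<close> is normalized
  per vertex, hence the factor \<open>length os\<close> for a cell.\<close>

lemma shortcut_paths_exist:
  fixes Ps :: "(int \<times> int) \<times> (int \<times> int) \<Rightarrow> (int \<times> int) list list" and H :: "real \<Rightarrow> real"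
  assumes Ps: "\<And>x y p. (x, y) \<in> set ds \<Longrightarrow> p \<in> set (Ps (x, y)) \<Longrightarrow>
      2 \<le> length p \<and> hd p = x \<and> last p = y \<and>
      successively (\<lambda>u w. adj u w \<and> u \<noteq> w \<and> level u + level w < level x + level y) p"
    and size: "\<And>d. d \<in> set ds \<Longrightarrow> length (Ps d) \<le> K \<and> length (concat (Ps d)) + 2 \<le> K"
    and "2 \<le> K"
    and H: "\<And>p. p \<in> {0..1} \<Longrightarrow> 0 \<le> H p"
      "\<And>p. p \<in> {0..1} \<Longrightarrow> (\<Sum>d\<leftarrow>ds. avoid_poly {fst d, snd d} (map set (Ps d)) p) = length os * H p"
  shows "\<exists>r (I :: ((int \<times> int) \<times> (int \<times> int) \<times> (int \<times> int)) set) ed P. shortcut_paths G r K I ed P \<and>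
    card I \<le> length ds * (1 + c) * card (verts G) \<and>
    (\<forall>p\<in>{0..1}. (\<Sum>i\<in>I. avoid_poly (ed i) (map set (P i)) p)
      \<le> H p * card (verts G) + length ds * (1 + c) * sqrt (card (verts G)))"
proof -
  define N where "N = real (card (verts G))"
  define ed where "ed = (\<lambda>(b, (x, y)). {e (b + x), e (b + y)})"
  \<comment> \<open>\<open>U\<close> may overshoot the graph, so indices that describe no edge are
    dropped.\<close>
  define I where "I = {i \<in> U \<times> set ds. ed i \<in> edges G}"
  define P where "P = (\<lambda>(b, d). if b \<in> B then map (map (\<lambda>q. e (b + q))) (Ps d) else [])"
  have fin_I: "finite I" using finite_U by (simp add: I_def)
  have bulk: "B \<times> set ds \<subseteq> I"
    using B_subset cell_edges adj_edge by (auto simp: I_def ed_def)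
  have card_ds: "card (set ds) = length ds" by (rule distinct_card[OF distinct_ds])
  have B_le: "real (card B) \<le> N"
  proof -
    have "1 * card B \<le> length os * card B"
      using os_nonempty by (intro mult_right_mono) (auto simp: Suc_le_eq)
    then have "card B \<le> card (verts G)" using card_cells by linarith
    then show ?thesis by (simp add: N_def)
  qed
  have sqrt_N: "sqrt N \<le> N"
  proof (cases "card (verts G) = 0")
    case False
    then have "1 \<le> N" by (simp add: N_def)
    then show ?thesis using real_sqrt_le_mono[of N "N * N"] by simp
  qed (simp add: N_def)
  have sub: "E \<in> edges G \<Longrightarrow> E \<subseteq> verts G" for E
    using edge_ends by blast
  have "shortcut_paths G edge_level K I ed P"
    unfolding shortcut_paths_def
  proof (intro conjI ballI)
    show "edges G \<subseteq> ed ` I"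
      using edges_subset unfolding I_def ed_def by blast
    fix i assume i: "i \<in> I"
    then obtain b x y where bxy: "i = (b, (x, y))" "(x, y) \<in> set ds" by (auto simp: I_def)
    show "ed i \<subseteq> verts G" using i sub by (auto simp: I_def)
    show "card (ed i) \<le> 2"
      unfolding bxy ed_def by (auto simp: card_insert_if)
    show "length (P i) \<le> K" "length (concat (P i)) + 2 \<le> K"
      using size[OF bxy(2)] \<open>2 \<le> K\<close> by (simp_all add: P_def bxy(1) map_concat[symmetric])
    fix p assume p: "p \<in> set (P i)"
    then have b: "b \<in> B" by (auto simp: P_def bxy split: if_splits)
    then obtain q where q: "q \<in> set (Ps (x, y))" "p = map (\<lambda>q. e (b + q)) q"
      using p by (auto simp: P_def bxy)
    note * = Ps[OF bxy(2) q(1)]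
    have "successively adj q"
      using * by (auto elim: successively_mono)
    then show "set p \<subseteq> verts G"
      unfolding q(2) using * b by (auto intro!: successively_adj_verts[of b q])
    have "q \<noteq> []" using * by auto
    then show "p \<noteq> []" "ed i = {hd p, last p}"
      using * by (simp_all add: q(2) bxy(1) ed_def hd_map last_map)
    \<comment> \<open>Translation by \<open>b\<close> adds \<open>2 * level b\<close> to every edge,
      so comparisons between offsets carry over to all cells.\<close>
    have lev: "edge_level (ed i) = 2 * level b + (level x + level y)"
      using cell_edges[OF bxy(2)] by (simp add: bxy(1) ed_def edge_level_e level_add)
    show "successively (\<lambda>x y. {x, y} \<in> edges G \<and> edge_level {x, y} < edge_level (ed i)) p"
      unfolding q(2) successively_map
    proof (rule successively_mono[of _ q])
      show "successively (\<lambda>u w. adj u w \<and> u \<noteq> w \<and> level u + level w < level x + level y) q"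
        using * by blast
    next
      fix u w assume "adj u w \<and> u \<noteq> w \<and> level u + level w < level x + level y"
      then show "{e (b + u), e (b + w)} \<in> edges G \<and> edge_level {e (b + u), e (b + w)} < edge_level (ed i)"
        using adj_edge[OF b] by (simp add: lev edge_level_e level_add)
    qed
  qed (rule fin_I)
  moreover have "card I \<le> length ds * (1 + c) * N"
  proof -
    have "card I \<le> card (U \<times> set ds)"
      using finite_U by (intro card_mono) (auto simp: I_def)
    then have "real (card I) \<le> real (length ds) * real (card U)"
      using card_ds by (simp add: card_cartesian_product mult.commute flip: of_nat_mult)
    also have "\<dots> \<le> length ds * (N + c * N)"
    proof (rule mult_left_mono)
      have "c * sqrt N \<le> c * N" using sqrt_N c_nonneg by (intro mult_left_mono)
      then show "real (card U) \<le> N + c * N" using bulk_U B_le unfolding N_def by linarith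
    qed simp
    finally show ?thesis by (simp add: algebra_simps)
  qed
  moreover have "(\<Sum>i\<in>I. avoid_poly (ed i) (map set (P i)) p)
      \<le> H p * N + length ds * (1 + c) * sqrt N" if p: "p \<in> {0..1}" for p
  proof -
    have "(\<Sum>i\<in>I. avoid_poly (ed i) (map set (P i)) p)
        = (\<Sum>i\<in>I - B \<times> set ds. avoid_poly (ed i) (map set (P i)) p)
          + (\<Sum>i\<in>B \<times> set ds. avoid_poly (ed i) (map set (P i)) p)"
      by (rule sum.subset_diff[OF bulk fin_I])
    also have "(\<Sum>i\<in>B \<times> set ds. avoid_poly (ed i) (map set (P i)) p)
        = (\<Sum>(b, d)\<in>B \<times> set ds. avoid_poly {fst d, snd d} (map set (Ps d)) p)"
    proof (rule sum.cong)
      fix i assume "i \<in> B \<times> set ds"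
      then obtain b x y where i: "i = (b, (x, y))" "b \<in> B" by auto
      then show "avoid_poly (ed i) (map set (P i)) p
          = (case i of (b, d) \<Rightarrow> avoid_poly {fst d, snd d} (map set (Ps d)) p)"
        using avoid_poly_image[OF inj_shift[of b], of "{x, y}" "map set (Ps (x, y))" p]
        by (simp add: P_def ed_def o_def)
    qed simp
    also have "\<dots> = card B * (length os * H p)"
      by (simp add: sum.cartesian_product[symmetric] H(2)[OF p, symmetric]
          sum_list_distinct_conv_sum_set distinct_ds)
    also have "\<dots> \<le> H p * N"
      using mult_left_mono[OF of_nat_mono[OF card_cells] H(1)[OF p]] by (simp add: mult_ac N_def)
    also have "(\<Sum>i\<in>I - B \<times> set ds. avoid_poly (ed i) (map set (P i)) p) \<le> (\<Sum>i\<in>I - B \<times> set ds. 1)"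
    proof (rule sum_mono)
      fix i assume "i \<in> I - B \<times> set ds"
      then have "P i = []" by (auto simp: P_def I_def split: if_splits)
      then show "avoid_poly (ed i) (map set (P i)) p \<le> 1"
        using p by (simp add: power_le_one)
    qed
    also have "\<dots> = real (card (I - B \<times> set ds))"
      by simp
    also have "\<dots> \<le> card ((U - B) \<times> set ds)"
      using finite_U by (intro of_nat_mono card_mono) (auto simp: I_def)
    also have "\<dots> = length ds * (real (card U) - card B)"
      using card_Diff_subset[OF finite_B B_subset] card_mono[OF finite_U B_subset]
      by (simp add: card_cartesian_product card_ds of_nat_diff)
    also have "\<dots> \<le> length ds * ((1 + c) * sqrt N)"
    proof (rule mult_left_mono)
      have "0 \<le> sqrt N" by (simp add: N_def)
      moreover have "(1 + c) * sqrt N = sqrt N + c * sqrt N" by (simp add: algebra_simps)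
      ultimately show "real (card U) - card B \<le> (1 + c) * sqrt N"
        using bulk_U unfolding N_def by linarith
    qed simp
    finally show ?thesis by (simp add: mult.assoc)
  qed
  ultimately show ?thesis unfolding N_def by blast
qed

end

section \<open>Coordinates for the three lattices\<close>

text \<open>An edge at \<open>e z\<close> leaves or enters along one of at most three directions,
  which makes six candidates.\<close>

lemma bounded_degree_graph_steps:
  fixes e :: "int \<times> int \<Rightarrow> 'a"
  assumes "inj e" "finite (verts G)" "length D \<le> 3"
    and "\<And>E. E \<in> edges G \<Longrightarrow> \<exists>u d. e u \<in> verts G \<and> e (u + d) \<in> verts G \<and> d \<in> set D \<and> E = {e u, e (u + d)}"
  shows "bounded_degree_graph G 6"
proof
  show "finite (verts G)" by fact
  show "\<exists>u\<in>verts G. \<exists>w\<in>verts G. E = {u, w}" if "E \<in> edges G" for E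
    using assms(4)[OF that] by blast
  fix x assume "x \<in> verts G"
  show "card {E \<in> edges G. x \<in> E} \<le> 6"
  proof (cases "x \<in> range e")
    case True
    then obtain z where z: "x = e z" by blast
    let ?S = "(\<lambda>d. {e z, e (z + d)}) ` set D \<union> (\<lambda>d. {e (z - d), e z}) ` set D"
    have "{E \<in> edges G. x \<in> E} \<subseteq> ?S"
    proof
      fix E assume "E \<in> {E \<in> edges G. x \<in> E}"
      then obtain u d where ud: "d \<in> set D" "E = {e u, e (u + d)}" "e z \<in> E"
        using assms(4) z by blast
      then consider "u = z" | "u = z - d"
        using assms(1) by (auto dest: injD)
      then show "E \<in> ?S" using ud by cases auto
    qed
    then have "card {E \<in> edges G. x \<in> E} \<le> card ?S" by (intro card_mono) auto
    also have "\<dots> \<le> card ((\<lambda>d. {e z, e (z + d)}) ` set D) + card ((\<lambda>d. {e (z - d), e z}) ` set D)"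
      by (rule card_Un_le)
    also have "\<dots> \<le> card (set D) + card (set D)" by (intro add_mono card_image_le) auto
    also have "\<dots> \<le> 6" using card_length[of D] assms(3) by simp
    finally show ?thesis .
  next
    case False
    then have none: "{E \<in> edges G. x \<in> E} = {}" using assms(4) by fastforce
    show ?thesis unfolding none by simp
  qed
qed

section \<open>The square and triangular lattices on an integer grid\<close>

definition grid_pos :: "int \<times> int \<Rightarrow> plane" where
  "grid_pos v = (real_of_int (fst v), real_of_int (snd v))"

lemma inj_grid_pos: "inj grid_pos"
  by (auto simp: inj_def grid_pos_def)

lemma grid_pos_diff: "grid_pos u - grid_pos v = grid_pos (u - v)"
  by (simp add: grid_pos_def)

definition grid_box :: "nat \<Rightarrow> (int \<times> int) set" where
  "grid_box n = {1..int n} \<times> {1..int n}"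

lemma grid_eq: "grid n = grid_pos ` grid_box n"
proof -
  have "(real i, real j) \<in> grid_pos ` grid_box n" if "i \<in> {1..n}" "j \<in> {1..n}" for i j
    using that by (intro image_eqI[of _ _ "(int i, int j)"]) (auto simp: grid_pos_def grid_box_def)
  moreover have "grid_pos (x, y) \<in> grid n" if "(x, y) \<in> grid_box n" for x y
  proof -
    have "grid_pos (x, y) = (real (nat x), real (nat y))" "nat x \<in> {1..n}" "nat y \<in> {1..n}"
      using that by (auto simp: grid_pos_def grid_box_def)
    then show ?thesis unfolding grid_def by blast
  qed
  ultimately show ?thesis by (auto simp: grid_def)
qed

definition grid_graph :: "nat \<Rightarrow> (int \<times> int) list \<Rightarrow> plane graph" where
  "grid_graph n D = \<lparr>verts = grid_pos ` grid_box n,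
     edges = {{grid_pos u, grid_pos w} | u w. u \<in> grid_box n \<and> w \<in> grid_box n \<and> w - u \<in> set D}\<rparr>"

text \<open>Between integer points the squared distance is a sum of two integer squares; it equals
  one only if a single coordinate differs, and differs by one.\<close>

lemma square_lattice_eq: "square_lattice n = grid_graph n [(1, 0), (0, 1)]"
proof -
  have dist: "dist (grid_pos u) (grid_pos w) = 1 \<longleftrightarrow>
      w - u \<in> {(1, 0), (0, 1)} \<or> u - w \<in> {(1, 0), (0, 1)}" for u w
  proof -
    obtain a b c d where uw: "u = (a, b)" "w = (c, d)" by fastforce
    have "dist (grid_pos u) (grid_pos w) = 1 \<longleftrightarrow> (a - c)\<^sup>2 + (b - d)\<^sup>2 = 1"
      unfolding uw grid_pos_def dist_prod_def dist_real_def
      by (simp flip: of_int_diff of_int_power of_int_add)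
    also have "\<dots> \<longleftrightarrow> (\<bar>a - c\<bar> = 1 \<and> b = d) \<or> (a = c \<and> \<bar>b - d\<bar> = 1)"
    proof
      assume *: "(a - c)\<^sup>2 + (b - d)\<^sup>2 = 1"
      have "(a - c)\<^sup>2 \<ge> 0" "(b - d)\<^sup>2 \<ge> 0" by simp_all
      then have "(a - c)\<^sup>2 = 0 \<and> (b - d)\<^sup>2 = 1 \<or> (a - c)\<^sup>2 = 1 \<and> (b - d)\<^sup>2 = 0"
        using * by linarith
      then show "(\<bar>a - c\<bar> = 1 \<and> b = d) \<or> (a = c \<and> \<bar>b - d\<bar> = 1)"
        by (auto simp: power2_eq_1_iff)
    next
      assume "(\<bar>a - c\<bar> = 1 \<and> b = d) \<or> (a = c \<and> \<bar>b - d\<bar> = 1)"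
      then show "(a - c)\<^sup>2 + (b - d)\<^sup>2 = 1"
        by (metis add.right_neutral add_0 diff_self one_power2 power2_abs zero_power2)
    qed
    also have "\<dots> \<longleftrightarrow> w - u \<in> {(1, 0), (0, 1)} \<or> u - w \<in> {(1, 0), (0, 1)}"
      unfolding uw by auto
    finally show ?thesis .
  qed
  have "{{u, v} | u v. u \<in> grid_pos ` grid_box n \<and> v \<in> grid_pos ` grid_box n \<and> dist u v = 1}
      = {{grid_pos u, grid_pos w} | u w. u \<in> grid_box n \<and> w \<in> grid_box n \<and> dist (grid_pos u) (grid_pos w) = 1}"
    by blast
  also have "\<dots> = {{grid_pos u, grid_pos w} | u w. u \<in> grid_box n \<and> w \<in> grid_box n \<and> w - u \<in> {(1, 0), (0, 1)}}"
    unfolding dist by (auto simp only: insert_commute)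
  finally show ?thesis
    by (simp add: square_lattice_def grid_graph_def grid_eq)
qed

lemma triangular_lattice_eq: "triangular_lattice n = grid_graph n [(1, 0), (0, 1), (1, -1)]"
proof -
  have step: "grid_pos w - grid_pos u \<in> {(1, 0), (0, 1), (1, -1)} \<longleftrightarrow> w - u \<in> {(1, 0), (0, 1), (1, -1)}" for u w
    unfolding grid_pos_diff by (auto simp: grid_pos_def prod_eq_iff)
  have "{{u, v} | u v. u \<in> grid_pos ` grid_box n \<and> v \<in> grid_pos ` grid_box n \<and> v - u \<in> {(1, 0), (0, 1), (1, -1)}}
      = {{grid_pos u, grid_pos w} | u w. u \<in> grid_box n \<and> w \<in> grid_box n \<and> grid_pos w - grid_pos u \<in> {(1, 0), (0, 1), (1, -1)}}"
    by blast
  then show ?thesis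
    unfolding step by (simp add: triangular_lattice_def grid_graph_def grid_eq)
qed

text \<open>The radius covers all explicit paths used below; the widest, in the hexagonal lattice,
  reach first coordinate -6.\<close>

definition near :: "int \<times> int \<Rightarrow> bool" where
  "near x \<longleftrightarrow> \<bar>fst x\<bar> \<le> 6 \<and> \<bar>snd x\<bar> \<le> 6"

definition grid_adj :: "(int \<times> int) list \<Rightarrow> int \<times> int \<Rightarrow> int \<times> int \<Rightarrow> bool" where
  "grid_adj D x y \<longleftrightarrow> near x \<and> near y \<and> (y - x \<in> set D \<or> x - y \<in> set D)"

lemma card_grid_box: "card (grid_box n) = n\<^sup>2"
  by (simp add: grid_box_def card_cartesian_product power2_eq_square)

lemma card_grid_graph: "card (verts (grid_graph n D)) = n\<^sup>2"
  unfolding grid_graph_def by (simp add: card_image[OF inj_on_subset[OF inj_grid_pos subset_UNIV]] card_grid_box)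

lemma grid_graph_bounded:
  assumes "length D \<le> 3"
  shows "bounded_degree_graph (grid_graph n D) 6"
proof (rule bounded_degree_graph_steps[OF inj_grid_pos _ assms])
  show "finite (verts (grid_graph n D))" by (simp add: grid_graph_def grid_box_def)
  fix E assume "E \<in> edges (grid_graph n D)"
  then obtain u w where "u \<in> grid_box n" "w \<in> grid_box n" "w - u \<in> set D" "E = {grid_pos u, grid_pos w}"
    by (auto simp: grid_graph_def)
  then show "\<exists>u d. grid_pos u \<in> verts (grid_graph n D) \<and> grid_pos (u + d) \<in> verts (grid_graph n D) \<and>
      d \<in> set D \<and> E = {grid_pos u, grid_pos (u + d)}"
    by (intro exI[of _ u] exI[of _ "w - u"]) (auto simp: grid_graph_def)
qed

lemma grid_graph_periodic:
  assumes D: "length D \<le> 3" "distinct D" "0 \<notin> set D" "\<forall>d\<in>set D. near d"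
  shows "periodic_graph (grid_graph n D) 6 grid_pos (grid_adj D) [(0, 0)] (map (\<lambda>d. ((0, 0), d)) D)
    ({7..int n - 6} \<times> {7..int n - 6}) (grid_box n) 24"
proof -
  interpret bounded_degree_graph "grid_graph n D" 6 by (rule grid_graph_bounded[OF D(1)])
  have bulk: "b + x \<in> grid_box n" if "b \<in> {7..int n - 6} \<times> {7..int n - 6}" "near x" for b x
    using that by (cases x) (auto simp: grid_box_def near_def)
  \<comment> \<open>A margin of 6 on each side leaves \<open>(n - 12)\<^sup>2\<close> base points,
    so at most \<open>24 * n\<close> vertices are lost, and \<open>n\<close> is the square root of
    the number of vertices.\<close>
  have bound: "real (n\<^sup>2) \<le> card ({7..int n - 6} \<times> {7..int n - 6}) + 24 * sqrt (n\<^sup>2)"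
  proof (cases "12 \<le> n")
    case True
    then have "real (card ({7..int n - 6} \<times> {7..int n - 6})) = (real n - 12)\<^sup>2"
      by (simp add: card_cartesian_product power2_eq_square of_nat_diff nat_diff_distrib)
    then show ?thesis by (simp add: power2_eq_square algebra_simps)
  next
    case False
    then have "n * n \<le> 24 * n" by (intro mult_right_mono) auto
    then have "real (n * n) \<le> real (24 * n)" by (rule of_nat_mono)
    then have "real n * real n \<le> 24 * real n" by simp
    also have "\<dots> \<le> card ({7..int n - 6} \<times> {7..int n - 6}) + 24 * real n" by simp
    finally have "real (n\<^sup>2) \<le> card ({7..int n - 6} \<times> {7..int n - 6}) + 24 * real n"
      by (simp only: power2_eq_square of_nat_mult)
    moreover have "sqrt (real (n\<^sup>2)) = real n" by simp
    ultimately show ?thesis by simp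
  qed
  show ?thesis
  proof unfold_locales
    show "inj grid_pos" by (rule inj_grid_pos)
    show "finite (grid_box n)" by (simp add: grid_box_def)
    show "{7..int n - 6} \<times> {7..int n - 6} \<subseteq> grid_box n" by (auto simp: grid_box_def)
    fix b x y
    assume b: "b \<in> {7..int n - 6} \<times> {7..int n - 6}"
    show "{grid_pos (b + x), grid_pos (b + y)} \<in> edges (grid_graph n D)" if gadj: "grid_adj D x y"
    proof -
      have xy: "b + x \<in> grid_box n" "b + y \<in> grid_box n" using bulk[OF b] gadj by (auto simp: grid_adj_def)
      consider "y - x \<in> set D" | "x - y \<in> set D" using gadj by (auto simp: grid_adj_def)
      then show ?thesis
      proof cases
        case 1
        then show ?thesis using xy unfolding grid_graph_def
          by (simp del: split_paired_Ex) (intro exI[of _ "b + x"] exI[of _ "b + y"], simp)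
      next
        case 2
        then show ?thesis using xy unfolding grid_graph_def
          by (simp del: split_paired_Ex) (intro exI[of _ "b + y"] exI[of _ "b + x"], simp add: insert_commute)
      qed
    qed
    show "grid_pos (b + x) \<in> verts (grid_graph n D)" if "x \<in> set [(0, 0)]"
      using bulk[OF b, of x] that by (auto simp: grid_graph_def near_def)
  next
    show "inj_on (\<lambda>(b, x). b + x) (({7..int n - 6} \<times> {7..int n - 6}) \<times> set [(0, 0)])"
      by (auto simp: inj_on_def)
    show "distinct (map (\<lambda>d. ((0::int, 0::int), d)) D)"
      using D(2) by (simp add: distinct_map inj_on_def)
    show "grid_adj D x y \<and> x \<noteq> y" if "(x, y) \<in> set (map (\<lambda>d. ((0, 0), d)) D)" for x y
      using that D(3,4) by (auto simp: grid_adj_def near_def zero_prod_def)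
    show "edges (grid_graph n D) \<subseteq> (\<lambda>(b, x, y). {grid_pos (b + x), grid_pos (b + y)}) `
        (grid_box n \<times> set (map (\<lambda>d. ((0, 0), d)) D))"
    proof
      fix E assume "E \<in> edges (grid_graph n D)"
      then obtain u w where uw: "u \<in> grid_box n" "w - u \<in> set D" "E = {grid_pos u, grid_pos w}"
        by (auto simp: grid_graph_def)
      then show "E \<in> (\<lambda>(b, x, y). {grid_pos (b + x), grid_pos (b + y)}) `
          (grid_box n \<times> set (map (\<lambda>d. ((0, 0), d)) D))"
        by (intro image_eqI[of _ _ "(u, (0, 0), w - u)"]) (auto simp: zero_prod_def[symmetric])
    qed
    show "real (card (grid_box n)) \<le> real (card ({7..int n - 6} \<times> {7..int n - 6})) + 24 * sqrt (real (card (verts (grid_graph n D))))"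
      unfolding card_grid_graph card_grid_box by (rule bound)
    show "real (card (verts (grid_graph n D))) \<le> real (length [(0, 0)] * card ({7..int n - 6} \<times> {7..int n - 6}))
        + 24 * sqrt (real (card (verts (grid_graph n D))))"
      unfolding card_grid_graph using bound by simp
  qed auto
qed

section \<open>The hexagonal lattice in integer coordinates\<close>

definition hex_pos :: "int \<times> int \<Rightarrow> plane" where
  "hex_pos v = (real_of_int (fst v) / 2, sqrt 3 / 2 * real_of_int (snd v))"

lemma inj_hex_pos: "inj hex_pos"
  by (auto simp: inj_def hex_pos_def)

text \<open>In the units of \<open>hex_pos\<close>, half a side by half the height of a hexagon,
  centres and corners are integer points. Row \<open>i\<close> of column \<open>j\<close> has
  \<open>y = 2 * i + j mod 2\<close>; thanks to the parity condition one bound on \<open>y\<close>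
  covers both the even columns and the shorter odd ones.\<close>

definition hcentres :: "nat \<Rightarrow> (int \<times> int) set" where
  "hcentres m = {(3 * j, y) | j y. 0 \<le> j \<and> j < int m \<and> 0 \<le> y \<and> y \<le> 2 * int m - 2 \<and> even (y - j)}"

definition corner :: "nat \<Rightarrow> int \<times> int" where
  "corner k = [(2, 0), (1, 1), (-1, 1), (-2, 0), (-1, -1), (1, -1), (2, 0)] ! k"

lemma hex_centres_eq: "hex_centres m = hex_pos ` hcentres m"
proof (intro equalityI subsetI)
  fix c assume "c \<in> hex_centres m"
  then obtain i j where c: "c = (3 / 2 * real j, sqrt 3 * (real i + 1 / 2 * real (j mod 2)))"
    "j < m" "if even j then i < m else i + 1 < m" by (auto simp: hex_centres_def)
  have "c = hex_pos (3 * int j, 2 * int i + int (j mod 2))"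
    by (simp add: c(1) hex_pos_def algebra_simps)
  moreover have "(3 * int j, 2 * int i + int (j mod 2)) \<in> hcentres m"
    using c(2,3) by (auto simp: hcentres_def odd_iff_mod_2_eq_one split: if_splits)
  ultimately show "c \<in> hex_pos ` hcentres m" by blast
next
  fix c assume "c \<in> hex_pos ` hcentres m"
  then obtain j y where c: "c = hex_pos (3 * j, y)" "0 \<le> j" "j < int m" "0 \<le> y" "y \<le> 2 * int m - 2" "even (y - j)"
    by (auto simp: hcentres_def)
  define i where "i = nat (y div 2)"
  have y: "y = 2 * int i + int (nat j mod 2)"
    using c(2,4,6) unfolding i_def by (auto simp: nat_mod_distrib[symmetric] zmod_int) presburger+
  have "int (nat j mod 2) = j mod 2" using c(2) by (simp add: zmod_int)
  then have "if even (nat j) then i < m else i + 1 < m"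
    using c(2,5) y by (auto simp: odd_iff_mod_2_eq_one even_nat_iff)
  moreover have "c = (3 / 2 * real (nat j), sqrt 3 * (real i + 1 / 2 * real (nat j mod 2)))"
    using c(2) by (simp add: c(1) hex_pos_def y algebra_simps)
  ultimately show "c \<in> hex_centres m"
    using c(2,3) unfolding hex_centres_def
    by (intro CollectI exI[of _ i] exI[of _ "nat j"] conjI) linarith+
qed

lemma hex_corner_eq:
  assumes "k \<le> 6"
  shows "hex_corner (hex_pos c) k = hex_pos (c + corner k)"
proof -
  have angles: "cos (pi * 2 / 3) = - (1 / 2)" "sin (pi * 2 / 3) = sqrt 3 / 2"
    "cos (pi * 4 / 3) = - (1 / 2)" "sin (pi * 4 / 3) = - (sqrt 3 / 2)"
    "cos (pi * 5 / 3) = 1 / 2" "sin (pi * 5 / 3) = - (sqrt 3 / 2)"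
  proof -
    have eqs: "pi * 2 / 3 = pi - pi / 3" "pi * 4 / 3 = pi + pi / 3" "pi * 5 / 3 = 2 * pi - pi / 3" by simp_all
    show "cos (pi * 2 / 3) = - (1 / 2)" "sin (pi * 2 / 3) = sqrt 3 / 2"
      "cos (pi * 4 / 3) = - (1 / 2)" "sin (pi * 4 / 3) = - (sqrt 3 / 2)"
      "cos (pi * 5 / 3) = 1 / 2" "sin (pi * 5 / 3) = - (sqrt 3 / 2)"
      unfolding eqs cos_diff sin_diff cos_add sin_add cos_60 sin_60 by simp_all
  qed
  have "k = 0 \<or> k = 1 \<or> k = 2 \<or> k = 3 \<or> k = 4 \<or> k = 5 \<or> k = 6" using assms by linarith
  then show ?thesis
    by (elim disjE) (simp_all add: hex_corner_def hex_pos_def corner_def prod_eq_iff angles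
        cos_60 sin_60 field_simps)
qed

definition hex_dirs :: "(int \<times> int) list" where
  "hex_dirs = [(-2, 0), (1, 1), (1, -1)]"

text \<open>Offsets are taken from a vertex whose horizontal edge leaves to the left; in doubled
  coordinates these are the vertices with first coordinate \<open>1\<close> modulo \<open>3\<close>.\<close>

definition hex_adj :: "int \<times> int \<Rightarrow> int \<times> int \<Rightarrow> bool" where
  "hex_adj x y \<longleftrightarrow> near x \<and> near y \<and> even (fst x + snd x) \<and>
    (fst x mod 3 = 0 \<and> y - x \<in> set hex_dirs \<or> fst y mod 3 = 0 \<and> x - y \<in> set hex_dirs)"

text \<open>In column \<open>j\<close> the ordinate is \<open>2 * i + (j + 1) mod 2\<close> with
  \<open>i = y div 2\<close>, so these vertices are parametrized by a product and easily
  counted.\<close>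

definition left_verts :: "int set \<Rightarrow> int set \<Rightarrow> (int \<times> int) set" where
  "left_verts J I = {(3 * j + 1, y) | j y. j \<in> J \<and> y div 2 \<in> I \<and> odd (y + j)}"

lemma left_verts_eq: "left_verts J I = (\<lambda>(j, i). (3 * j + 1, 2 * i + (j + 1) mod 2)) ` (J \<times> I)"
proof -
  have 1: "(2 * i + (j + 1) mod 2) div 2 = i" "odd (2 * i + (j + 1) mod 2 + j)" for i j :: int
    by presburger+
  have 2: "y = 2 * (y div 2) + (j + 1) mod 2" if "odd (y + j)" for y j :: int
    using that by presburger
  show ?thesis
  proof (intro equalityI subsetI)
    fix v assume "v \<in> left_verts J I"
    then obtain j y where "v = (3 * j + 1, y)" "j \<in> J" "y div 2 \<in> I" "odd (y + j)"
      unfolding left_verts_def by blast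
    then show "v \<in> (\<lambda>(j, i). (3 * j + 1, 2 * i + (j + 1) mod 2)) ` (J \<times> I)"
      using 2[of y j] by (intro image_eqI[of _ _ "(j, y div 2)"]) simp_all
  next
    fix v assume "v \<in> (\<lambda>(j, i). (3 * j + 1, 2 * i + (j + 1) mod 2)) ` (J \<times> I)"
    then obtain j i where v: "j \<in> J" "i \<in> I" "v = (3 * j + 1, 2 * i + (j + 1) mod 2)"
      by (elim imageE SigmaE) simp
    show "v \<in> left_verts J I"
      unfolding left_verts_def v(3)
      by (intro CollectI exI[of _ j] exI[of _ "2 * i + (j + 1) mod 2"] conjI refl v(1) 1(2))
        (unfold 1(1), rule v(2))
  qed
qed

lemma card_left_verts: "card (left_verts J I) = card J * card I"
  unfolding left_verts_eq by (subst card_image) (auto simp: inj_on_def card_cartesian_product)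

lemma hexagonal_lattice_verts:
  "verts (hexagonal_lattice m) = {hex_pos (c + corner k) | c k. c \<in> hcentres m \<and> k < 6}"
proof -
  have "{hex_corner c k | c k. c \<in> hex_pos ` hcentres m \<and> k < 6}
      = {hex_corner (hex_pos c) k | c k. c \<in> hcentres m \<and> k < 6}"
    by blast
  also have "\<dots> = {hex_pos (c + corner k) | c k. c \<in> hcentres m \<and> k < 6}"
    by (intro Collect_cong ex_cong1) (auto simp: hex_corner_eq)
  finally show ?thesis
    by (simp add: hexagonal_lattice_def hex_centres_eq)
qed

lemma hexagonal_lattice_edges:
  "edges (hexagonal_lattice m) =
    {{hex_pos (c + corner k), hex_pos (c + corner (Suc k))} | c k. c \<in> hcentres m \<and> k < 6}"
proof -
  have "{{hex_corner c k, hex_corner c (Suc k)} | c k. c \<in> hex_pos ` hcentres m \<and> k < 6}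
      = {{hex_corner (hex_pos c) k, hex_corner (hex_pos c) (Suc k)} | c k. c \<in> hcentres m \<and> k < 6}"
    by blast
  also have "\<dots> = {{hex_pos (c + corner k), hex_pos (c + corner (Suc k))} | c k. c \<in> hcentres m \<and> k < 6}"
    by (intro Collect_cong ex_cong1) (auto simp: hex_corner_eq)
  finally show ?thesis
    by (simp add: hexagonal_lattice_def hex_centres_eq)
qed

text \<open>Corners 1, 3 and 5 are those with first coordinate 1 modulo 3, and each side has exactly
  one of them as an end.\<close>

lemma hex_corner_edge:
  assumes "c \<in> hcentres m" "k < 6"
  shows "\<exists>a\<in>left_verts {-1..int m} {-1..int m - 1}. \<exists>d\<in>set hex_dirs.
    {c + corner k, c + corner (Suc k)} = {a, a + d}"
proof -
  obtain j y where c: "c = (3 * j, y)" "0 \<le> j" "j < int m" "0 \<le> y" "y \<le> 2 * int m - 2" "even (y - j)"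
    using assms(1) by (auto simp: hcentres_def)
  have A: "(3 * i + 1, z) \<in> left_verts {-1..int m} {-1..int m - 1}"
    if "i \<in> {j - 1, j}" "z \<in> {y - 1, y, y + 1}" "odd (z + i)" for i z
  proof -
    have "z div 2 \<in> {-1..int m - 1}" using that c by auto
    then show ?thesis using that c unfolding left_verts_def by auto
  qed
  have "k = 0 \<or> k = 1 \<or> k = 2 \<or> k = 3 \<or> k = 4 \<or> k = 5" using assms(2) by linarith
  then show ?thesis
  proof (elim disjE)
    assume "k = 0"
    then show ?thesis using c(6) A[of j "y + 1"]
      by (intro bexI[of _ "(3 * j + 1, y + 1)"] bexI[of _ "(1, -1)"])
        (simp_all add: c(1) corner_def hex_dirs_def doubleton_eq_iff)
  next
    assume "k = 1"
    then show ?thesis using c(6) A[of j "y + 1"]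
      by (intro bexI[of _ "(3 * j + 1, y + 1)"] bexI[of _ "(-2, 0)"])
        (simp_all add: c(1) corner_def hex_dirs_def doubleton_eq_iff)
  next
    assume "k = 2"
    then show ?thesis using c(6) A[of "j - 1" y]
      by (intro bexI[of _ "(3 * (j - 1) + 1, y)"] bexI[of _ "(1, 1)"])
        (simp_all add: c(1) corner_def hex_dirs_def doubleton_eq_iff)
  next
    assume "k = 3"
    then show ?thesis using c(6) A[of "j - 1" y]
      by (intro bexI[of _ "(3 * (j - 1) + 1, y)"] bexI[of _ "(1, -1)"])
        (simp_all add: c(1) corner_def hex_dirs_def doubleton_eq_iff)
  next
    assume "k = 4"
    then show ?thesis using c(6) A[of j "y - 1"]
      by (intro bexI[of _ "(3 * j + 1, y - 1)"] bexI[of _ "(-2, 0)"])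
        (simp_all add: c(1) corner_def hex_dirs_def doubleton_eq_iff)
  next
    assume "k = 5"
    then show ?thesis using c(6) A[of j "y - 1"]
      by (intro bexI[of _ "(3 * j + 1, y - 1)"] bexI[of _ "(1, 1)"])
        (simp_all add: c(1) corner_def hex_dirs_def doubleton_eq_iff)
  qed
qed

text \<open>The vertex \<open>(3 * j + 1, y)\<close> is shared by the hexagons just above and just
  below it in column \<open>j\<close>, and the sides of these two provide all three edges.\<close>

lemma hex_edge_present:
  assumes "0 \<le> j" "j < int m" "1 \<le> y" "y \<le> 2 * int m - 3" "odd (y + j)" "d \<in> set hex_dirs"
  shows "{hex_pos (3 * j + 1, y), hex_pos ((3 * j + 1, y) + d)} \<in> edges (hexagonal_lattice m)"
proof -
  have c: "(3 * j, y + 1) \<in> hcentres m" "(3 * j, y - 1) \<in> hcentres m"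
    using assms by (auto simp: hcentres_def)
  have E: "{hex_pos (c + corner k), hex_pos (c + corner (Suc k))} \<in> edges (hexagonal_lattice m)"
    if "c \<in> hcentres m" "k < 6" for c k
    using that unfolding hexagonal_lattice_edges by blast
  consider "d = (-2, 0)" | "d = (1, 1)" | "d = (1, -1)" using assms(6) by (auto simp: hex_dirs_def)
  then show ?thesis
    using E[OF c(2), of 1] E[OF c(1), of 5] E[OF c(2), of 0]
    by cases (simp_all add: corner_def insert_commute add.commute)
qed

lemma finite_hexagonal_verts: "finite (verts (hexagonal_lattice m))"
proof -
  have "hcentres m \<subseteq> (\<lambda>j. 3 * j) ` {0..int m} \<times> {0..2 * int m}"
    by (auto simp: hcentres_def)
  then have "finite (hcentres m)" by (rule finite_subset) auto
  moreover have "verts (hexagonal_lattice m) = (\<lambda>(c, k). hex_pos (c + corner k)) ` (hcentres m \<times> {..<6})"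
    by (auto simp: hexagonal_lattice_verts)
  ultimately show ?thesis by simp
qed

lemma hexagonal_bounded: "bounded_degree_graph (hexagonal_lattice m) 6"
proof (rule bounded_degree_graph_steps[OF inj_hex_pos finite_hexagonal_verts, of hex_dirs])
  show "length hex_dirs \<le> 3" by (simp add: hex_dirs_def)
  fix E assume "E \<in> edges (hexagonal_lattice m)"
  then obtain c k where c: "c \<in> hcentres m" "k < 6" "E = hex_pos ` {c + corner k, c + corner (Suc k)}"
    by (auto simp: hexagonal_lattice_edges)
  obtain a d where ad: "d \<in> set hex_dirs" "{c + corner k, c + corner (Suc k)} = {a, a + d}"
    using hex_corner_edge[OF c(1,2)] by blast
  have "hex_pos (c + corner (Suc k)) \<in> verts (hexagonal_lattice m)"
  proof (cases "k = 5")
    case True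
    then have "corner (Suc k) = corner 0" by (simp add: corner_def)
    then show ?thesis using c(1) unfolding hexagonal_lattice_verts
      by (intro CollectI exI[of _ c] exI[of _ 0]) simp
  next
    case False
    then show ?thesis using c(1,2) unfolding hexagonal_lattice_verts
      by (intro CollectI exI[of _ c] exI[of _ "Suc k"]) simp
  qed
  moreover have "hex_pos (c + corner k) \<in> verts (hexagonal_lattice m)"
    using c(1,2) unfolding hexagonal_lattice_verts by (intro CollectI exI[of _ c] exI[of _ k]) simp
  ultimately have "hex_pos ` {a, a + d} \<subseteq> verts (hexagonal_lattice m)"
    unfolding ad(2)[symmetric] by simp
  then show "\<exists>u d. hex_pos u \<in> verts (hexagonal_lattice m) \<and> hex_pos (u + d) \<in> verts (hexagonal_lattice m) \<and>
      d \<in> set hex_dirs \<and> E = {hex_pos u, hex_pos (u + d)}"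
    using ad c(3) by (intro exI[of _ a] exI[of _ d]) simp
qed

text \<open>Corners 1, 3 and 5 lie in \<open>left_verts\<close>; corners 0, 2 and 4 are translates
  of such points by \<open>(-2, 0)\<close>, along a horizontal edge that may lie outside the
  lattice.\<close>

lemma hexagonal_verts_le:
  "card (verts (hexagonal_lattice m)) \<le> 2 * ((m + 2) * (m + 1))"
proof -
  let ?U = "left_verts {-1..int m} {-1..int m - 1}"
  have "c + corner k \<in> ?U \<union> (\<lambda>u. u + (-2, 0)) ` ?U" if c: "c \<in> hcentres m" "k < 6" for c k
  proof -
    obtain j y where c: "c = (3 * j, y)" "0 \<le> j" "j < int m" "0 \<le> y" "y \<le> 2 * int m - 2" "even (y - j)"
      using c(1) by (auto simp: hcentres_def)
    have A: "(3 * i + 1, z) \<in> ?U" if "i \<in> {j - 1, j, j + 1}" "z \<in> {y - 1, y, y + 1}" "odd (z + i)" for i z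
    proof -
      have "z div 2 \<in> {-1..int m - 1}" using that c by auto
      then show ?thesis using that c unfolding left_verts_def by auto
    qed
    have B: "(3 * i - 1, z) \<in> (\<lambda>u. u + (-2, 0)) ` ?U"
      if "i \<in> {j - 1, j, j + 1}" "z \<in> {y - 1, y, y + 1}" "odd (z + i)" for i z
      using A[OF that] by (intro image_eqI[of _ _ "(3 * i + 1, z)"]) auto
    have "k = 0 \<or> k = 1 \<or> k = 2 \<or> k = 3 \<or> k = 4 \<or> k = 5" using that(2) by linarith
    then show ?thesis
      using c(6) A[of j "y + 1"] A[of "j - 1" y] A[of j "y - 1"] B[of "j + 1" y] B[of j "y + 1"] B[of j "y - 1"]
      by (elim disjE) (simp_all add: corner_def c(1) add.commute)
  qed
  then have "verts (hexagonal_lattice m) \<subseteq> hex_pos ` (?U \<union> (\<lambda>u. u + (-2, 0)) ` ?U)"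
    unfolding hexagonal_lattice_verts by blast
  moreover have fin: "finite ?U" unfolding left_verts_eq by simp
  ultimately have "card (verts (hexagonal_lattice m)) \<le> card (?U \<union> (\<lambda>u. u + (-2, 0)) ` ?U)"
    by (intro surj_card_le) auto
  also have "\<dots> \<le> card ?U + card ?U"
    by (intro order.trans[OF card_Un_le] add_mono card_image_le fin order.refl)
  also have "\<dots> = 2 * ((m + 2) * (m + 1))"
    by (simp add: card_left_verts nat_add_distrib)
  finally show ?thesis .
qed

text \<open>A crude bound that turns boundary errors of order \<open>m\<close> into errors of order
  sqrt N.\<close>

lemma hexagonal_verts_ge:
  assumes "m \<ge> 1"
  shows "m\<^sup>2 \<le> 4 * card (verts (hexagonal_lattice m))"
proof -
  let ?N = "card (verts (hexagonal_lattice m))"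
  have "hex_pos ` left_verts {0..int m - 1} {1..int m - 1} \<subseteq> verts (hexagonal_lattice m)"
  proof -
    have "hex_pos (3 * j + 1, y) \<in> verts (hexagonal_lattice m)"
      if "j \<in> {0..int m - 1}" "y div 2 \<in> {1..int m - 1}" "odd (y + j)" for j y
    proof -
      have "(3 * j, y - 1) \<in> hcentres m" using that by (auto simp: hcentres_def)
      then show ?thesis
        unfolding hexagonal_lattice_verts
        by (intro CollectI exI[of _ "(3 * j, y - 1)"] exI[of _ 1]) (simp add: corner_def)
    qed
    then show ?thesis by (auto simp: left_verts_def)
  qed
  then have "card (hex_pos ` left_verts {0..int m - 1} {1..int m - 1}) \<le> ?N"
    by (intro card_mono finite_hexagonal_verts)
  then have 1: "m * (m - 1) \<le> ?N"
    by (simp add: card_image[OF inj_on_subset[OF inj_hex_pos subset_UNIV]] card_left_verts nat_minus_as_int)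
  have "hex_pos ((0, 0) + corner 0) \<in> verts (hexagonal_lattice m)"
    unfolding hexagonal_lattice_verts using assms
    by (intro CollectI exI[of _ "(0, 0)"] exI[of _ 0]) (auto simp: hcentres_def)
  then have 2: "1 \<le> ?N"
    using finite_hexagonal_verts by (auto simp: Suc_le_eq card_gt_0_iff)
  show ?thesis
  proof (cases "m = 1")
    case False
    then have "m * m \<le> m * (2 * (m - 1))" using assms by (intro mult_left_mono) auto
    also have "\<dots> = 2 * (m * (m - 1))" by simp
    also have "\<dots> \<le> 4 * ?N" using 1 by linarith
    finally show ?thesis by (simp add: power2_eq_square)
  qed (use 2 in simp)
qed

lemma hexagonal_periodic:
  assumes "m \<ge> 1"
  shows "periodic_graph (hexagonal_lattice m) 6 hex_pos hex_adj [(0, 0), (-2, 0)]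
    (map (\<lambda>d. ((0, 0), d)) hex_dirs) (left_verts {2..int m - 3} {4..int m - 6})
    (left_verts {-1..int m} {-1..int m - 1}) 64"
proof -
  interpret bounded_degree_graph "hexagonal_lattice m" 6 by (rule hexagonal_bounded)
  let ?B = "left_verts {2..int m - 3} {4..int m - 6}"
  let ?U = "left_verts {-1..int m} {-1..int m - 1}"
  define N where "N = real (card (verts (hexagonal_lattice m)))"
  have star: "{hex_pos (b + x), hex_pos (b + x + d)} \<in> edges (hexagonal_lattice m)"
    if bx: "b \<in> ?B" "near x" "even (fst x + snd x)" "fst x mod 3 = 0" "d \<in> set hex_dirs" for b x d
  proof -
    obtain j y where b: "b = (3 * j + 1, y)" "j \<in> {2..int m - 3}" "y div 2 \<in> {4..int m - 6}" "odd (y + j)"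
      using bx(1) by (auto simp: left_verts_def)
    obtain s t where x: "x = (3 * s, t)" using bx(4) by (metis mod_0_imp_dvd dvdE prod.collapse)
    have st: "\<bar>3 * s\<bar> \<le> 6" "\<bar>t\<bar> \<le> 6" "even (s + t)" using bx(2,3) by (auto simp: x near_def)
    have "b + x = (3 * (j + s) + 1, y + t)" by (simp add: b(1) x)
    moreover have "odd (y + t + (j + s))" using b(4) st(3) by presburger
    moreover have "1 \<le> y + t" "y + t \<le> 2 * int m - 3" using b(3) st(2) by auto
    moreover have "0 \<le> j + s" "j + s < int m" using b(2) st(1) by auto
    ultimately show ?thesis
      using hex_edge_present[of "j + s" m "y + t" d] bx(5) by simp
  qed
  have adj: "{hex_pos (b + x), hex_pos (b + y)} \<in> edges (hexagonal_lattice m)"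
    if b: "b \<in> ?B" and xy: "hex_adj x y" for b x y
  proof -
    \<comment> \<open>\<open>hex_adj\<close> states the parity for \<open>x\<close> alone; every
      direction preserves it, so it passes to \<open>y\<close>.\<close>
    have "even (fst y + snd y)" if "x - y \<in> set hex_dirs" "even (fst x + snd x)"
    proof -
      have "even (fst d + snd d)" if "d \<in> set hex_dirs" for d
        using that by (auto simp: hex_dirs_def)
      then have "even (fst (x - y) + snd (x - y))" using that(1) .
      moreover have "fst y + snd y = fst x + snd x - (fst (x - y) + snd (x - y))" by simp
      ultimately show ?thesis using that(2) by (simp only: dvd_diff)
    qed
    then show ?thesis
      using xy star[OF b, of x "y - x"] star[OF b, of y "x - y"]
      by (auto simp: hex_adj_def insert_commute)
  qed
  have m_le: "real m \<le> 2 * sqrt N"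
  proof -
    have "(real m)\<^sup>2 \<le> 4 * N"
      using of_nat_mono[OF hexagonal_verts_ge[OF assms], where ?'a = real] by (simp add: N_def)
    then have "real m \<le> sqrt (4 * N)" by (rule real_le_rsqrt)
    then show ?thesis by (simp add: real_sqrt_mult)
  qed
  \<comment> \<open>For \<open>9 \<le> m\<close> there are \<open>(m - 4) * (m - 9)\<close> base
    points, short of \<open>(m + 2) * (m + 1)\<close> by \<open>16 * m - 34\<close>. With two
    vertices per cell and \<open>m \<le> 2 * sqrt N\<close> this leads to the constant 64.\<close>
  have count: "(m + 2) * (m + 1) \<le> card ?B + 16 * m"
  proof (cases "9 \<le> m")
    case True
    define k where "k = m - 9"
    have "m = k + 9" using True by (simp add: k_def)
    then show ?thesis by (simp add: card_left_verts nat_add_distrib algebra_simps)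
  next
    case False
    then have "m * m \<le> 8 * m" by (intro mult_right_mono) auto
    moreover have "(m + 2) * (m + 1) = m * m + 3 * m + 2" by (simp add: algebra_simps)
    ultimately have "(m + 2) * (m + 1) \<le> 16 * m" using assms by linarith
    then show ?thesis by simp
  qed
  have card_U: "card ?U = (m + 2) * (m + 1)" by (simp add: card_left_verts nat_add_distrib)
  show ?thesis
  proof unfold_locales
    show "inj hex_pos" by (rule inj_hex_pos)
    show "finite ?U" unfolding left_verts_eq by simp
    show "?B \<subseteq> ?U" by (auto simp: left_verts_def)
    show "{hex_pos (b + x), hex_pos (b + y)} \<in> edges (hexagonal_lattice m)"
      if "b \<in> ?B" "hex_adj x y" for b x y by (rule adj[OF that])
    show "hex_pos (b + x) \<in> verts (hexagonal_lattice m)" if "b \<in> ?B" "x \<in> set [(0, 0), (-2, 0)]" for b x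
    proof -
      have "{hex_pos (b + (0, 0)), hex_pos (b + (-2, 0))} \<in> edges (hexagonal_lattice m)"
        by (rule adj[OF that(1)]) (simp add: hex_adj_def near_def hex_dirs_def)
      then have "{hex_pos (b + (0, 0)), hex_pos (b + (-2, 0))} \<subseteq> verts (hexagonal_lattice m)"
        using edge_ends by (fastforce simp: doubleton_eq_iff)
      then show ?thesis using that(2) by auto
    qed
    show "inj_on (\<lambda>(b, x). b + x) (?B \<times> set [(0, 0), (-2, 0)])"
    proof -
      \<comment> \<open>The two vertices of a cell are told apart by the first coordinate modulo 3,
        which is 1 for the base point and 2 for its left neighbour.\<close>
      have mod: "fst b mod 3 = 1" if "b \<in> ?B" for b
        using that unfolding left_verts_def by auto
      have key: "x = x'" if "b \<in> ?B" "b' \<in> ?B" "b + x = b' + x'"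
        "x \<in> {(0, 0), (-2, 0)}" "x' \<in> {(0, 0), (-2, 0)}" for b b' x x' :: "int \<times> int"
      proof (rule ccontr)
        assume "x \<noteq> x'"
        then have "fst x = 0 \<and> fst x' = -2 \<or> fst x = -2 \<and> fst x' = 0"
          using that(4,5) by (elim insertE emptyE) simp_all
        moreover have sum: "fst b + fst x = fst b' + fst x'"
          using arg_cong[OF that(3), of fst] by simp
        moreover have mod3: False if "u = v - 2" "u mod 3 = 1" "v mod 3 = 1" for u v :: int
          using that by presburger
        ultimately show False
          using mod3[of "fst b" "fst b'"] mod3[of "fst b'" "fst b"] mod[OF that(1)] mod[OF that(2)]
          by (elim disjE conjE) simp_all
      qed
      show ?thesis
      proof (rule inj_onI)
        fix u v
        assume u: "u \<in> ?B \<times> set [(0, 0), (-2, 0)]" and v: "v \<in> ?B \<times> set [(0, 0), (-2, 0)]"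
          and eq: "(case u of (b, x) \<Rightarrow> b + x) = (case v of (b, x) \<Rightarrow> b + x)"
        have sum: "fst u + snd u = fst v + snd v" using eq by (simp add: case_prod_unfold)
        have "snd u = snd v"
          by (rule key[OF _ _ sum]) (use u v in \<open>auto simp: mem_Times_iff\<close>)
        then show "u = v" using sum by (simp add: prod_eq_iff)
      qed
    qed
    show "distinct (map (\<lambda>d. ((0::int, 0::int), d)) hex_dirs)" by (simp add: hex_dirs_def)
    show "hex_adj x y \<and> x \<noteq> y" if "(x, y) \<in> set (map (\<lambda>d. ((0, 0), d)) hex_dirs)" for x y
      using that by (auto simp: hex_adj_def hex_dirs_def near_def)
    show "edges (hexagonal_lattice m) \<subseteq> (\<lambda>(b, x, y). {hex_pos (b + x), hex_pos (b + y)}) `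
        (?U \<times> set (map (\<lambda>d. ((0, 0), d)) hex_dirs))"
    proof
      fix E assume "E \<in> edges (hexagonal_lattice m)"
      then obtain c k where c: "c \<in> hcentres m" "k < 6" "E = hex_pos ` {c + corner k, c + corner (Suc k)}"
        by (auto simp: hexagonal_lattice_edges)
      obtain a d where ad: "a \<in> ?U" "d \<in> set hex_dirs" "{c + corner k, c + corner (Suc k)} = {a, a + d}"
        using hex_corner_edge[OF c(1,2)] by blast
      then show "E \<in> (\<lambda>(b, x, y). {hex_pos (b + x), hex_pos (b + y)}) `
          (?U \<times> set (map (\<lambda>d. ((0, 0), d)) hex_dirs))"
        unfolding c(3) ad(3)
        by (intro image_eqI[of _ _ "(a, (0, 0), d)"]) (auto simp: zero_prod_def[symmetric])
    qed
    show "real (card ?U) \<le> real (card ?B) + 64 * sqrt (real (card (verts (hexagonal_lattice m))))"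
    proof -
      have "real (card ?U) \<le> real (card ?B + 16 * m)" unfolding card_U by (intro of_nat_mono count)
      then show ?thesis using m_le by (simp add: N_def)
    qed
    show "real (card (verts (hexagonal_lattice m))) \<le> real (length [(0, 0), (-2, 0)] * card ?B)
        + 64 * sqrt (real (card (verts (hexagonal_lattice m))))"
    proof -
      have "card (verts (hexagonal_lattice m)) \<le> 2 * card ?B + 32 * m"
        using hexagonal_verts_le[of m] count by linarith
      then have "real (card (verts (hexagonal_lattice m))) \<le> real (2 * card ?B + 32 * m)" by (rule of_nat_mono)
      then show ?thesis using m_le by (simp add: N_def)
    qed
  qed auto
qed

section \<open>Numerical bounds\<close>

text \<open>Each polynomial is expanded to first order around a point near the maximum; the second
  order remainder is positive because its Bernstein coefficients are.\<close>

lemma square_poly_le: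
  fixes p :: real
  assumes "0 \<le> p" "p \<le> 1"
  shows "p - 2 * p ^ 2 + p ^ 4 + 2 * p ^ 5 - 3 * p ^ 6 + p ^ 7 \<le> 663 / 5000"
proof -
  define q where "q = 1 - p"
  define R where "R =
      834311662691297 / 500000000000000 * q ^ 5
      + 754243292130797 / 100000000000000 * (p * q ^ 4)
      + 599069763370297 / 50000000000000 * (p ^ 2 * q ^ 3)
      + 341246926409797 / 50000000000000 * (p ^ 3 * q ^ 2)
      + 197030631249297 / 100000000000000 * (p ^ 4 * q)
      + 126476727888797 / 500000000000000 * p ^ 5"
  have "0 \<le> R"
    unfolding R_def using assms
    by (intro add_nonneg_nonneg mult_nonneg_nonneg zero_le_power) (auto simp: q_def)
  then have "0 \<le> (p - 281 / 1000)\<^sup>2 * R"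
    by (intro mult_nonneg_nonneg) auto
  also have "\<dots> = (663 / 5000 - (p - 2 * p ^ 2 + p ^ 4 + 2 * p ^ 5 - 3 * p ^ 6 + p ^ 7)) - (1121769283530674639 / 1000000000000000000000 + 989094943294233 / 1000000000000000000 * (p - 281 / 1000))"
    unfolding R_def q_def by algebra
  finally have "1121769283530674639 / 1000000000000000000000 + 989094943294233 / 1000000000000000000 * (p - 281 / 1000) \<le> 663 / 5000 - (p - 2 * p ^ 2 + p ^ 4 + 2 * p ^ 5 - 3 * p ^ 6 + p ^ 7)"
    by (simp only: diff_ge_0_iff_ge)
  \<comment> \<open>The expansion point is not the exact maximizer, so a linear term remains; its
    slope is positive and the line is already positive at \<open>p = 0\<close>.\<close>
  moreover have "0 \<le> 1121769283530674639 / 1000000000000000000000 + 989094943294233 / 1000000000000000000 * (p - 281 / 1000)"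
    using assms(1) by (simp add: field_simps)
  ultimately have "0 \<le> 663 / 5000 - (p - 2 * p ^ 2 + p ^ 4 + 2 * p ^ 5 - 3 * p ^ 6 + p ^ 7)"
    by (rule order.trans[rotated])
  then show ?thesis
    by (simp only: diff_ge_0_iff_ge)
qed

lemma triangular_poly_le:
  fixes p :: real
  assumes "0 \<le> p" "p \<le> 1"
  shows "p - 3 * p ^ 2 + 2 * p ^ 3 + 2 * p ^ 4 - 3 * p ^ 5 + p ^ 6 \<le> 201 / 2000"
proof -
  define q where "q = 1 - p"
  define R where "R =
      37892239 / 20000000 * q ^ 4 + 25429399 / 5000000 * (p * q ^ 3)
      + 31112677 / 10000000 * (p ^ 2 * q ^ 2) + 5416719 / 5000000 * (p ^ 3 * q)
      + 3266879 / 20000000 * p ^ 4"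
  have "0 \<le> R"
    unfolding R_def using assms
    by (intro add_nonneg_nonneg mult_nonneg_nonneg zero_le_power) (auto simp: q_def)
  then have "0 \<le> (p - 23 / 100)\<^sup>2 * R"
    by (intro mult_nonneg_nonneg) auto
  also have "\<dots> = (201 / 2000 - (p - 3 * p ^ 2 + 2 * p ^ 3 + 2 * p ^ 4 - 3 * p ^ 5 + p ^ 6)) - (1052047011 / 1000000000000 + 16891721 / 5000000000 * (p - 23 / 100))"
    unfolding R_def q_def by algebra
  finally have "1052047011 / 1000000000000 + 16891721 / 5000000000 * (p - 23 / 100) \<le> 201 / 2000 - (p - 3 * p ^ 2 + 2 * p ^ 3 + 2 * p ^ 4 - 3 * p ^ 5 + p ^ 6)"
    by (simp only: diff_ge_0_iff_ge)
  moreover have "0 \<le> 1052047011 / 1000000000000 + 16891721 / 5000000000 * (p - 23 / 100)"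
    using assms(1) by (simp add: field_simps)
  ultimately have "0 \<le> 201 / 2000 - (p - 3 * p ^ 2 + 2 * p ^ 3 + 2 * p ^ 4 - 3 * p ^ 5 + p ^ 6)"
    by (rule order.trans[rotated])
  then show ?thesis
    by (simp only: diff_ge_0_iff_ge)
qed

lemma hexagonal_poly_le:
  fixes p :: real
  assumes "0 \<le> p" "p \<le> 1"
  shows "2 * p - 3 * p ^ 2 + p ^ 5 + p ^ 6 - p ^ 7 \<le> 857 / 2500"
proof -
  define q where "q = 1 - p"
  define R where "R =
      4455971 / 1600000 * q ^ 5 + 4307501 / 320000 * (p * q ^ 4)
      + 4015671 / 160000 * (p ^ 2 * q ^ 3) + 3367281 / 160000 * (p ^ 3 * q ^ 2)
      + 2053131 / 320000 * (p ^ 4 * q) + 1268021 / 1600000 * p ^ 5"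
  have "0 \<le> R"
    unfolding R_def using assms
    by (intro add_nonneg_nonneg mult_nonneg_nonneg zero_le_power) (auto simp: q_def)
  then have "0 \<le> (p - 7 / 20)\<^sup>2 * R"
    by (intro mult_nonneg_nonneg) auto
  also have "\<dots> = (857 / 2500 - (2 * p - 3 * p ^ 2 + p ^ 5 + p ^ 6 - p ^ 7)) - (4931763 / 1280000000 + 404703 / 64000000 * (p - 7 / 20))"
    unfolding R_def q_def by algebra
  finally have "4931763 / 1280000000 + 404703 / 64000000 * (p - 7 / 20) \<le> 857 / 2500 - (2 * p - 3 * p ^ 2 + p ^ 5 + p ^ 6 - p ^ 7)"
    by (simp only: diff_ge_0_iff_ge)
  moreover have "0 \<le> 4931763 / 1280000000 + 404703 / 64000000 * (p - 7 / 20)"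
    using assms(1) by (simp add: field_simps)
  ultimately have "0 \<le> 857 / 2500 - (2 * p - 3 * p ^ 2 + p ^ 5 + p ^ 6 - p ^ 7)"
    by (rule order.trans[rotated])
  then show ?thesis
    by (simp only: diff_ge_0_iff_ge)
qed

section \<open>Explicit paths in the three lattices\<close>

lemma square_descent_paths:
  assumes "G \<in> square_lattices"
  shows "\<exists>r P. descent_paths G r 10 P \<and>
    (\<forall>p\<in>{0..1}. (\<Sum>v\<in>verts G. avoid_poly {v} (map set (P v)) p)
      \<le> 663 / 5000 * card (verts G) + 24 * sqrt (card (verts G)))"
proof -
  obtain n where G: "G = grid_graph n [(1, 0), (0, 1)]"
    using assms by (auto simp: square_lattices_def square_lattice_eq)
  interpret periodic_graph G 6 grid_pos "grid_adj [(1, 0), (0, 1)]" "[(0, 0)]"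
    "map (\<lambda>d. ((0, 0), d)) [(1, 0), (0, 1)]" "{7..int n - 6} \<times> {7..int n - 6}" "grid_box n" 24
    unfolding G by (rule grid_graph_periodic) (auto simp: near_def zero_prod_def)
  \<comment> \<open>A vertex is counted if its left and lower neighbours are absent and climbing one
    or two steps in its column opens no way to the left. The probability is
    \<open>p * (1 - p)\<^sup>2 * (1 - p\<^sup>2 - p ^ 3 + p ^ 4)\<close>.\<close>
  define Ps :: "(int \<times> int) list list" where
    "Ps = [[(-1, 0)], [(0, 1), (-1, 1)], [(0, 1), (0, 2), (-1, 2)], [(0, -1)]]"
  show ?thesis
  proof (rule descent_paths_exist[where Ps = "\<lambda>_. Ps"])
    fix x p assume "x \<in> set [(0 :: int, 0 :: int)]" "p \<in> set Ps"
    then show "p \<noteq> [] \<and> successively (grid_adj [(1, 0), (0, 1)]) (x # p) \<and> level (last p) < level x"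
      by (auto simp: Ps_def grid_adj_def near_def level_def)
  next
    fix p :: real assume p: "p \<in> {0..1}"
    have "avoid_poly {(0, 0)} (map set Ps) p = p - 2 * p ^ 2 + p ^ 4 + 2 * p ^ 5 - 3 * p ^ 6 + p ^ 7"
      by (simp add: Ps_def card_insert_if eval_nat_numeral algebra_simps)
    then show "(\<Sum>x\<leftarrow>[(0, 0)]. avoid_poly {x} (map set Ps) p) \<le> length [(0 :: int, 0 :: int)] * (663 / 5000)"
      using square_poly_le[of p] p by simp
  qed (auto simp: Ps_def)
qed

lemma triangular_descent_paths:
  assumes "G \<in> triangular_lattices"
  shows "\<exists>r P. descent_paths G r 10 P \<and>
    (\<forall>p\<in>{0..1}. (\<Sum>v\<in>verts G. avoid_poly {v} (map set (P v)) p)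
      \<le> 201 / 2000 * card (verts G) + 24 * sqrt (card (verts G)))"
proof -
  obtain n where G: "G = grid_graph n [(1, 0), (0, 1), (1, -1)]"
    using assms by (auto simp: triangular_lattices_def triangular_lattice_eq)
  interpret periodic_graph G 6 grid_pos "grid_adj [(1, 0), (0, 1), (1, -1)]" "[(0, 0)]"
    "map (\<lambda>d. ((0, 0), d)) [(1, 0), (0, 1), (1, -1)]" "{7..int n - 6} \<times> {7..int n - 6}" "grid_box n" 24
    unfolding G by (rule grid_graph_periodic) (auto simp: near_def zero_prod_def)
  \<comment> \<open>All three lower neighbours are tested, and one path of two steps through the
    upper neighbour. The probability is \<open>p * (1 - p) ^ 3 * (1 - p\<^sup>2)\<close>.\<close>
  define Ps :: "(int \<times> int) list list" where
    "Ps = [[(-1, 0)], [(0, 1), (-1, 2)], [(0, -1)], [(-1, 1)]]"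
  show ?thesis
  proof (rule descent_paths_exist[where Ps = "\<lambda>_. Ps"])
    fix x p assume "x \<in> set [(0 :: int, 0 :: int)]" "p \<in> set Ps"
    then show "p \<noteq> [] \<and> successively (grid_adj [(1, 0), (0, 1), (1, -1)]) (x # p) \<and> level (last p) < level x"
      by (auto simp: Ps_def grid_adj_def near_def level_def)
  next
    fix p :: real assume p: "p \<in> {0..1}"
    have "avoid_poly {(0, 0)} (map set Ps) p = p - 3 * p ^ 2 + 2 * p ^ 3 + 2 * p ^ 4 - 3 * p ^ 5 + p ^ 6"
      by (simp add: Ps_def card_insert_if eval_nat_numeral algebra_simps)
    then show "(\<Sum>x\<leftarrow>[(0, 0)]. avoid_poly {x} (map set Ps) p) \<le> length [(0 :: int, 0 :: int)] * (201 / 2000)"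
      using triangular_poly_le[of p] p by simp
  qed (auto simp: Ps_def)
qed

lemma hexagonal_descent_paths:
  assumes "G \<in> hexagonal_lattices"
  shows "\<exists>r P. descent_paths G r 10 P \<and>
    (\<forall>p\<in>{0..1}. (\<Sum>v\<in>verts G. avoid_poly {v} (map set (P v)) p)
      \<le> 857 / 5000 * card (verts G) + 64 * sqrt (card (verts G)))"
proof -
  obtain m where G: "G = hexagonal_lattice m" and m: "m \<ge> 1"
    using assms by (auto simp: hexagonal_lattices_def)
  interpret periodic_graph G 6 hex_pos hex_adj "[(0, 0), (-2, 0)]"
    "map (\<lambda>d. ((0, 0), d)) hex_dirs" "left_verts {2..int m - 3} {4..int m - 6}"
    "left_verts {-1..int m} {-1..int m - 1}" 64
    unfolding G by (rule hexagonal_periodic[OF m])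
  \<comment> \<open>The vertex \<open>(-2, 0)\<close> has two lower neighbours. The vertex
    \<open>(0, 0)\<close> has one; going round the right it first reaches a lower vertex after three
    steps upwards or two downwards. These paths being disjoint, the sum is \<open>p * (1 - p) * (1 -
    p ^ 3) * (1 - p\<^sup>2) + p * (1 - p)\<^sup>2\<close>.\<close>
  define Ps :: "int \<times> int \<Rightarrow> (int \<times> int) list list" where
    "Ps x = (if x = (0, 0) then [[(-2, 0)], [(1, 1), (0, 2), (-2, 2)], [(1, -1), (0, -2)]]
      else [[(-3, 1)], [(-3, -1)]])" for x
  show ?thesis
  proof (rule descent_paths_exist[where Ps = Ps])
    fix x p assume "x \<in> set [(0 :: int, 0 :: int), (-2, 0)]" "p \<in> set (Ps x)"
    then show "p \<noteq> [] \<and> successively hex_adj (x # p) \<and> level (last p) < level x"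
      by (auto simp: Ps_def hex_adj_def hex_dirs_def near_def level_def)
  next
    fix p :: real assume p: "p \<in> {0..1}"
    have "avoid_poly {(0, 0)} (map set (Ps (0, 0))) p + avoid_poly {(-2, 0)} (map set (Ps (-2, 0))) p
        = 2 * p - 3 * p ^ 2 + p ^ 5 + p ^ 6 - p ^ 7"
      by (simp add: Ps_def card_insert_if eval_nat_numeral algebra_simps)
    then show "(\<Sum>x\<leftarrow>[(0, 0), (-2, 0)]. avoid_poly {x} (map set (Ps x)) p)
        \<le> length [(0 :: int, 0 :: int), (-2, 0)] * (857 / 5000)"
      using hexagonal_poly_le[of p] p by simp
  qed (auto simp: Ps_def)
qed

definition shortcut_family :: "plane graph \<Rightarrow> nat \<Rightarrow> real \<Rightarrow> (real \<Rightarrow> real) \<Rightarrow> bool" where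
  "shortcut_family G K c H \<longleftrightarrow> (\<exists>r (I :: ((int \<times> int) \<times> (int \<times> int) \<times> (int \<times> int)) set) ed P.
    shortcut_paths G r K I ed P \<and> real (card I) \<le> c * real (card (verts G)) \<and>
    (\<forall>p\<in>{0..1}. (\<Sum>i\<in>I. avoid_poly (ed i) (map set (P i)) p)
      \<le> H p * real (card (verts G)) + c * sqrt (real (card (verts G)))))"

text \<open>Per vertex there are two edges, less one for a full unit square and one for an 8-cycle
  around an absent vertex, of probability \<open>p ^ 8 - p ^ 9\<close>. The square cancels its right
  side, the 8-cycle the upper half of its right side.\<close>

lemma square_shortcut_paths:
  assumes "G \<in> square_lattices"
  shows "shortcut_family G 20 50 (\<lambda>p. 2 * p ^ 2 - p ^ 4 - p ^ 8 + p ^ 9)"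
proof -
  obtain n where G: "G = grid_graph n [(1, 0), (0, 1)]"
    using assms by (auto simp: square_lattices_def square_lattice_eq)
  interpret periodic_graph G 6 grid_pos "grid_adj [(1, 0), (0, 1)]" "[(0, 0)]"
    "map (\<lambda>d. ((0, 0), d)) [(1, 0), (0, 1)]" "{7..int n - 6} \<times> {7..int n - 6}" "grid_box n" 24
    unfolding G by (rule grid_graph_periodic) (auto simp: near_def zero_prod_def)
  define Ps :: "(int \<times> int) \<times> (int \<times> int) \<Rightarrow> (int \<times> int) list list" where
    "Ps d = (if snd d = (0, 1) then
      [[(0, 0), (-1, 0), (-1, 1), (0, 1)],
       [(0, 0), (0, -1), (-1, -1), (-2, -1), (-2, 0), (-2, 1), (-1, 1), (0, 1)]] else [])" for d
  have "shortcut_family G 20 (real (length (map (\<lambda>d. ((0 :: int, 0 :: int), d)) [(1 :: int, 0 :: int), (0, 1)])) * (1 + 24))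
      (\<lambda>p. 2 * p ^ 2 - p ^ 4 - p ^ 8 + p ^ 9)"
    unfolding shortcut_family_def
  proof (rule shortcut_paths_exist[where Ps = Ps])
    fix x y p assume "(x, y) \<in> set (map (\<lambda>d. ((0 :: int, 0 :: int), d)) [(1 :: int, 0 :: int), (0, 1)])" "p \<in> set (Ps (x, y))"
    then show "2 \<le> length p \<and> hd p = x \<and> last p = y \<and>
        successively (\<lambda>u w. grid_adj [(1, 0), (0, 1)] u w \<and> u \<noteq> w \<and> level u + level w < level x + level y) p"
      by (auto simp: Ps_def grid_adj_def near_def level_def split: if_splits)
  next
    fix p :: real assume p: "p \<in> {0..1}"
    have "p ^ 4 \<le> p ^ 2" "p ^ 8 \<le> p ^ 2" "0 \<le> p ^ 9"
      using p by (auto intro: power_decreasing)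
    then show "0 \<le> 2 * p ^ 2 - p ^ 4 - p ^ 8 + p ^ 9" by linarith
    show "(\<Sum>d\<leftarrow>map (\<lambda>d. ((0, 0), d)) [(1, 0), (0, 1)]. avoid_poly {fst d, snd d} (map set (Ps d)) p)
        = length [(0 :: int, 0 :: int)] * (2 * p ^ 2 - p ^ 4 - p ^ 8 + p ^ 9)"
      by (simp add: Ps_def card_insert_if eval_nat_numeral algebra_simps)
  qed (auto simp: Ps_def)
  then show ?thesis by simp
qed

text \<open>Per vertex there are three edges, less one for each of two triangles and one for a
  6-cycle around an absent vertex. The two triangles cancel edges of different directions.\<close>

lemma triangular_shortcut_paths:
  assumes "G \<in> triangular_lattices"
  shows "shortcut_family G 20 75 (\<lambda>p. 3 * p ^ 2 - 2 * p ^ 3 - p ^ 6 + p ^ 7)"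
proof -
  obtain n where G: "G = grid_graph n [(1, 0), (0, 1), (1, -1)]"
    using assms by (auto simp: triangular_lattices_def triangular_lattice_eq)
  interpret periodic_graph G 6 grid_pos "grid_adj [(1, 0), (0, 1), (1, -1)]" "[(0, 0)]"
    "map (\<lambda>d. ((0, 0), d)) [(1, 0), (0, 1), (1, -1)]" "{7..int n - 6} \<times> {7..int n - 6}" "grid_box n" 24
    unfolding G by (rule grid_graph_periodic) (auto simp: near_def zero_prod_def)
  define Ps :: "(int \<times> int) \<times> (int \<times> int) \<Rightarrow> (int \<times> int) list list" where
    "Ps d = (if snd d = (0, 1) then
      [[(0, 0), (-1, 0), (-2, 1), (-2, 2), (-1, 2), (0, 1)], [(0, 0), (-1, 1), (0, 1)]]
      else if snd d = (1, -1) then [[(0, 0), (0, -1), (1, -1)]] else [])" for d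
  have "shortcut_family G 20 (real (length (map (\<lambda>d. ((0 :: int, 0 :: int), d)) [(1 :: int, 0 :: int), (0, 1), (1, -1)])) * (1 + 24))
      (\<lambda>p. 3 * p ^ 2 - 2 * p ^ 3 - p ^ 6 + p ^ 7)"
    unfolding shortcut_family_def
  proof (rule shortcut_paths_exist[where Ps = Ps])
    fix x y p
    assume "(x, y) \<in> set (map (\<lambda>d. ((0 :: int, 0 :: int), d)) [(1 :: int, 0 :: int), (0, 1), (1, -1)])" "p \<in> set (Ps (x, y))"
    then show "2 \<le> length p \<and> hd p = x \<and> last p = y \<and>
        successively (\<lambda>u w. grid_adj [(1, 0), (0, 1), (1, -1)] u w \<and> u \<noteq> w \<and> level u + level w < level x + level y) p"
      by (auto simp: Ps_def grid_adj_def near_def level_def split: if_splits)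
  next
    fix p :: real assume p: "p \<in> {0..1}"
    have "p ^ 3 \<le> p ^ 2" "p ^ 6 \<le> p ^ 2" "0 \<le> p ^ 7"
      using p by (auto intro: power_decreasing)
    then show "0 \<le> 3 * p ^ 2 - 2 * p ^ 3 - p ^ 6 + p ^ 7" by linarith
    show "(\<Sum>d\<leftarrow>map (\<lambda>d. ((0, 0), d)) [(1, 0), (0, 1), (1, -1)]. avoid_poly {fst d, snd d} (map set (Ps d)) p)
        = length [(0 :: int, 0 :: int)] * (3 * p ^ 2 - 2 * p ^ 3 - p ^ 6 + p ^ 7)"
      by (simp add: Ps_def card_insert_if eval_nat_numeral algebra_simps)
  qed (auto simp: Ps_def)
  then show ?thesis by simp
qed

text \<open>Per cell there are three edges, less one for a hexagon and one for each of two
  12-cycles, which run round the three hexagons meeting at an absent vertex, \<open>(-3, -1)\<close>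
  or \<open>(-2, -2)\<close>. If both 12-cycles are present, so is the hexagon; hence their joint
  terms cancel.\<close>

lemma hexagonal_shortcut_paths:
  assumes "G \<in> hexagonal_lattices"
  shows "shortcut_family G 40 195 (\<lambda>p. (3 * p ^ 2 - p ^ 6 - 2 * p ^ 12 + 2 * p ^ 13) / 2)"
proof -
  obtain m where G: "G = hexagonal_lattice m" and m: "m \<ge> 1"
    using assms by (auto simp: hexagonal_lattices_def)
  interpret periodic_graph G 6 hex_pos hex_adj "[(0, 0), (-2, 0)]"
    "map (\<lambda>d. ((0, 0), d)) hex_dirs" "left_verts {2..int m - 3} {4..int m - 6}"
    "left_verts {-1..int m} {-1..int m - 1}" 64
    unfolding G by (rule hexagonal_periodic[OF m])
  define Ps :: "(int \<times> int) \<times> (int \<times> int) \<Rightarrow> (int \<times> int) list list" where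
    "Ps d = (if snd d = (1, -1) then
      [[(0, 0), (-2, 0), (-3, -1), (-2, -2), (0, -2), (1, -1)],
       [(0, 0), (-2, 0), (-3, 1), (-5, 1), (-6, 0), (-5, -1), (-6, -2), (-5, -3), (-3, -3), (-2, -2), (0, -2), (1, -1)],
       [(0, 0), (-2, 0), (-3, -1), (-5, -1), (-6, -2), (-5, -3), (-3, -3), (-2, -4), (0, -4), (1, -3), (0, -2), (1, -1)]]
      else [])" for d
  have "shortcut_family G 40 (real (length (map (\<lambda>d. ((0 :: int, 0 :: int), d)) hex_dirs)) * (1 + 64))
      (\<lambda>p. (3 * p ^ 2 - p ^ 6 - 2 * p ^ 12 + 2 * p ^ 13) / 2)"
    unfolding shortcut_family_def
  proof (rule shortcut_paths_exist[where Ps = Ps])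
    fix x y p
    assume "(x, y) \<in> set (map (\<lambda>d. ((0 :: int, 0 :: int), d)) hex_dirs)" "p \<in> set (Ps (x, y))"
    then show "2 \<le> length p \<and> hd p = x \<and> last p = y \<and>
        successively (\<lambda>u w. hex_adj u w \<and> u \<noteq> w \<and> level u + level w < level x + level y) p"
      by (auto simp: Ps_def hex_adj_def hex_dirs_def near_def level_def split: if_splits)
  next
    fix p :: real assume p: "p \<in> {0..1}"
    have "p ^ 6 \<le> p ^ 2" "p ^ 12 \<le> p ^ 2" "0 \<le> p ^ 13"
      using p by (auto intro: power_decreasing)
    then show "0 \<le> (3 * p ^ 2 - p ^ 6 - 2 * p ^ 12 + 2 * p ^ 13) / 2" by simp
    show "(\<Sum>d\<leftarrow>map (\<lambda>d. ((0, 0), d)) hex_dirs. avoid_poly {fst d, snd d} (map set (Ps d)) p)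
        = length [(0 :: int, 0 :: int), (-2, 0)] * ((3 * p ^ 2 - p ^ 6 - 2 * p ^ 12 + 2 * p ^ 13) / 2)"
      by (simp add: Ps_def hex_dirs_def card_insert_if eval_nat_numeral algebra_simps)
  qed (auto simp: Ps_def)
  then show ?thesis by (simp add: hex_dirs_def)
qed

lemma lattice_bounded_degree:
  assumes "G \<in> square_lattices \<union> triangular_lattices \<union> hexagonal_lattices"
  shows "bounded_degree_graph G 6"
  using assms hexagonal_bounded grid_graph_bounded[of "[(1, 0), (0, 1)]"]
    grid_graph_bounded[of "[(1, 0), (0, 1), (1, -1)]"]
  by (auto simp: square_lattices_def triangular_lattices_def hexagonal_lattices_def
      square_lattice_eq triangular_lattice_eq)

lemma blind_value_bounds:
  fixes M M' L c c' q :: real and H :: "real \<Rightarrow> real"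
  assumes deg: "\<And>G. G \<in> \<G> \<Longrightarrow> bounded_degree_graph G 6"
    and up: "\<And>G. G \<in> \<G> \<Longrightarrow> \<exists>r P. descent_paths G r K P \<and>
      (\<forall>p\<in>{0..1}. (\<Sum>v\<in>verts G. avoid_poly {v} (map set (P v)) p)
        \<le> M * card (verts G) + c * sqrt (card (verts G)))"
    and low: "\<And>G. G \<in> \<G> \<Longrightarrow> shortcut_family G K' c' H"
    and "M < M'" "0 < K" "0 < K'" "0 \<le> c'" "0 < q" "q < 1" "isCont H q" "L < q - H q"
  shows "\<exists>N\<^sub>0. \<forall>G \<tau>. G \<in> \<G> \<and> card (verts G) \<ge> N\<^sub>0 \<and> is_optimal G (blind G) \<tau> \<longrightarrow>
    L \<le> normalized_value G \<tau> \<and> normalized_value G \<tau> \<le> M'"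
proof -
  obtain N1 where N1: "\<forall>G \<tau>. G \<in> \<G> \<and> card (verts G) \<ge> N1 \<and> is_optimal G (blind G) \<tau> \<longrightarrow>
      normalized_value G \<tau> \<le> M'"
    using blind_value_upper[OF deg \<open>M < M'\<close> \<open>0 < K\<close> up] by blast
  obtain N2 where N2: "\<forall>G \<tau>. G \<in> \<G> \<and> card (verts G) \<ge> N2 \<and> is_optimal G (blind G) \<tau> \<longrightarrow>
      L \<le> normalized_value G \<tau>"
    using blind_value_lower[OF deg \<open>0 < K'\<close> \<open>0 \<le> c'\<close> \<open>0 < q\<close> \<open>q < 1\<close> \<open>isCont H q\<close>
        \<open>L < q - H q\<close> low[unfolded shortcut_family_def]] by blast
  show ?thesis
    using N1 N2 by (intro exI[of _ "max N1 N2"]) simp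
qed

theorem corollary5:
  "(\<exists>N\<^sub>0. \<forall>G \<tau>. G \<in> square_lattices \<and> card (verts G) \<ge> N\<^sub>0 \<and> is_optimal G (blind G) \<tau> \<longrightarrow>
      0.12953 \<le> normalized_value G \<tau> \<and> normalized_value G \<tau> \<le> 0.13268) \<and>
   (\<exists>N\<^sub>0. \<forall>G \<tau>. G \<in> triangular_lattices \<and> card (verts G) \<ge> N\<^sub>0 \<and> is_optimal G (blind G) \<tau> \<longrightarrow>
      0.09629 \<le> normalized_value G \<tau> \<and> normalized_value G \<tau> \<le> 0.10107) \<and>
   (\<exists>N\<^sub>0. \<forall>G \<tau>. G \<in> hexagonal_lattices \<and> card (verts G) \<ge> N\<^sub>0 \<and> is_optimal G (blind G) \<tau> \<longrightarrow>
      0.16738 \<le> normalized_value G \<tau> \<and> normalized_value G \<tau> \<le> 0.17144) \<and>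
   (\<forall>\<epsilon>::real. 0 < \<epsilon> \<and> \<epsilon> < 1 \<longrightarrow>
      (\<exists>N\<^sub>0. \<forall>G \<tau>b \<tau>f.
         G \<in> square_lattices \<union> triangular_lattices \<union> hexagonal_lattices \<and>
         card (verts G) \<ge> N\<^sub>0 \<and>
         is_optimal G (blind G) \<tau>b \<and> is_optimal G (full_information G) \<tau>f \<longrightarrow>
         normalized_value G \<tau>b \<le> normalized_value G \<tau>f \<and>
         normalized_value G \<tau>f \<le> normalized_value G \<tau>b + \<epsilon>))"
proof (intro conjI allI impI)
  show "\<exists>N\<^sub>0. \<forall>G \<tau>. G \<in> square_lattices \<and> card (verts G) \<ge> N\<^sub>0 \<and> is_optimal G (blind G) \<tau> \<longrightarrow>
      0.12953 \<le> normalized_value G \<tau> \<and> normalized_value G \<tau> \<le> 0.13268"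
    \<comment> \<open>In all three cases \<open>q\<close> is close to the maximizer of
      \<open>q - H q\<close>. The polynomial bounds 0.1326, 0.1005 and 0.1714 lie strictly below the
      claimed upper bounds, as \<open>M < M'\<close> requires.\<close>
    by (rule blind_value_bounds[OF lattice_bounded_degree square_descent_paths square_shortcut_paths,
          where q = "2698 / 10000"]) (auto intro!: continuous_intros simp: power_divide)
  show "\<exists>N\<^sub>0. \<forall>G \<tau>. G \<in> triangular_lattices \<and> card (verts G) \<ge> N\<^sub>0 \<and> is_optimal G (blind G) \<tau> \<longrightarrow>
      0.09629 \<le> normalized_value G \<tau> \<and> normalized_value G \<tau> \<le> 0.10107"
    by (rule blind_value_bounds[OF lattice_bounded_degree triangular_descent_paths triangular_shortcut_paths,
          where q = "2119 / 10000"]) (auto intro!: continuous_intros simp: power_divide)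
  show "\<exists>N\<^sub>0. \<forall>G \<tau>. G \<in> hexagonal_lattices \<and> card (verts G) \<ge> N\<^sub>0 \<and> is_optimal G (blind G) \<tau> \<longrightarrow>
      0.16738 \<le> normalized_value G \<tau> \<and> normalized_value G \<tau> \<le> 0.17144"
    by (rule blind_value_bounds[OF lattice_bounded_degree hexagonal_descent_paths hexagonal_shortcut_paths,
          where q = "33775 / 100000"]) (auto intro!: continuous_intros simp: power_divide)
  show "\<exists>N\<^sub>0. \<forall>G \<tau>b \<tau>f. G \<in> square_lattices \<union> triangular_lattices \<union> hexagonal_lattices \<and>
      card (verts G) \<ge> N\<^sub>0 \<and> is_optimal G (blind G) \<tau>b \<and> is_optimal G (full_information G) \<tau>f \<longrightarrow>
      normalized_value G \<tau>b \<le> normalized_value G \<tau>f \<and>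
      normalized_value G \<tau>f \<le> normalized_value G \<tau>b + \<epsilon>" if "0 < \<epsilon> \<and> \<epsilon> < 1" for \<epsilon> :: real
    by (rule full_information_close_to_blind[OF lattice_bounded_degree conjunct1[OF that]])
qed

end
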